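(* Let $n \geq 1$ and $(k_1,k_2,\ldots,k_n)\in\mathbb{Z}^n$. Then \[ \alpha(n;k_1,\ldots,k_n) = \sum_{A \in \mathcal{G}_n(k_1,\ldots,k_n)} (-1)^{\operatorname{sc}(A)}, \] where $\mathcal{G}_n(k_1,\ldots,k_n)$ is the (finite) set of Generalized Monotone Triangles of size $n$ with bottom row $(k_1,\ldots,k_n)$ and $\operatorname{sc}(A)$ is the total number of newcomers and sign-changing pairs in $A$.
   Context: A Monotone Triangle of size $n$ is a triangular array of integers $(a_{i,j})_{1\le j\le i\le n}$ (row $i$ consists of $a_{i,1},\ldots,a_{i,i}$; row $n$ is the bottom row) with $a_{i,j}<a_{i,j+1}$ and $a_{i+1,j}\le a_{i,j}\le a_{i+1,j+1}$. It is known that for each $n\ge 1$ there is a unique polynomial $\alpha(n;k_1,\ldots,k_n)$ in $n$ variables, of degree $n-1$ in each variable, whose value at every strictly increasing integer sequence $k_1<k_2<\cdots<k_n$ equals the number of Monotone Triangles with bottom row $(k_1,\ldots,k_n)$. A Generalized Monotone Triangle (GMT) of size $n$ is a triangular array of integers $(a_{i,j})_{1\le j\le i\le n}$ such that, whenever the indices involved exist: (1) $\min\{a_{i+1,j},a_{i+1,j+1}\}\le a_{i,j}\le \max\{a_{i+1,j},a_{i+1,j+1}\}$; (2) if $a_{i+1,j}\le a_{i+1,j+1}\le a_{i+1,j+2}$ then $a_{i,j}<a_{i,j+1}$; (3) if $a_{i,j}=a_{i+1,j}>a_{i+1,j+1}$ then $j\ge 2$ and $a_{i,j-1}=a_{i,j}$;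 and if $a_{i+1,j}>a_{i+1,j+1}=a_{i,j}$ then $j+1\le i$ and $a_{i,j+1}=a_{i,j}$. An entry $a_{i,j}$ ($i<n$) is a newcomer if $a_{i+1,j}>a_{i,j}>a_{i+1,j+1}$. A pair $(a_{i,j},a_{i,j+1})$ of consecutive entries in a row $i<n$ is sign-changing if $a_{i,j}=a_{i,j+1}=a_{i+1,j+1}$. *)

theory Defs
  imports Main "HOL.Rat"
begin

text \<open>A triangular array of size n is encoded as a function a :: nat => nat => int,
  entry a i j for 1 <= j <= i <= n (row n is the bottom row); outside this index
  range the function is required to be 0, so that arrays are determined by their entries.\<close>

definition tri_ext :: "nat \<Rightarrow> (nat \<Rightarrow> nat \<Rightarrow> int) \<Rightarrow> bool" where
  "tri_ext n a \<longleftrightarrow> (\<forall>i j. \<not> (1 \<le> j \<and> j \<le> i \<and> i \<le> n) \<longrightarrow> a i j = 0)"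

definition bottom_row :: "nat \<Rightarrow> int list \<Rightarrow> (nat \<Rightarrow> nat \<Rightarrow> int) \<Rightarrow> bool" where
  "bottom_row n ks a \<longleftrightarrow> (\<forall>j. 1 \<le> j \<and> j \<le> n \<longrightarrow> a n j = ks ! (j - 1))"

definition monotone_triangle :: "nat \<Rightarrow> (nat \<Rightarrow> nat \<Rightarrow> int) \<Rightarrow> bool" where
  "monotone_triangle n a \<longleftrightarrow> tri_ext n a \<and>
     (\<forall>i j. 1 \<le> j \<and> j + 1 \<le> i \<and> i \<le> n \<longrightarrow> a i j < a i (j + 1)) \<and>
     (\<forall>i j. 1 \<le> j \<and> j \<le> i \<and> i < n \<longrightarrow> a (i + 1) j \<le> a i j \<and> a i j \<le> a (i + 1) (j + 1))"

definition MT_set :: "nat \<Rightarrow> int list \<Rightarrow> (nat \<Rightarrow> nat \<Rightarrow> int) set" where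
  "MT_set n ks = {a. monotone_triangle n a \<and> bottom_row n ks a}"

definition GMT :: "nat \<Rightarrow> (nat \<Rightarrow> nat \<Rightarrow> int) \<Rightarrow> bool" where
  "GMT n a \<longleftrightarrow> tri_ext n a \<and>
     \<comment> \<open>(1)\<close>
     (\<forall>i j. 1 \<le> j \<and> j \<le> i \<and> i < n \<longrightarrow>
        min (a (i + 1) j) (a (i + 1) (j + 1)) \<le> a i j \<and>
        a i j \<le> max (a (i + 1) j) (a (i + 1) (j + 1))) \<and>
     \<comment> \<open>(2)\<close>
     (\<forall>i j. 1 \<le> j \<and> j + 1 \<le> i \<and> i < n \<longrightarrow>
        a (i + 1) j \<le> a (i + 1) (j + 1) \<and> a (i + 1) (j + 1) \<le> a (i + 1) (j + 2) \<longrightarrow>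
        a i j < a i (j + 1)) \<and>
     \<comment> \<open>(3)\<close>
     (\<forall>i j. 1 \<le> j \<and> j \<le> i \<and> i < n \<longrightarrow>
        (a i j = a (i + 1) j \<and> a (i + 1) j > a (i + 1) (j + 1) \<longrightarrow>
           2 \<le> j \<and> a i (j - 1) = a i j) \<and>
        (a (i + 1) j > a (i + 1) (j + 1) \<and> a (i + 1) (j + 1) = a i j \<longrightarrow>
           j + 1 \<le> i \<and> a i (j + 1) = a i j))"

definition GMT_set :: "nat \<Rightarrow> int list \<Rightarrow> (nat \<Rightarrow> nat \<Rightarrow> int) set" where
  "GMT_set n ks = {a. GMT n a \<and> bottom_row n ks a}"

definition newcomers :: "nat \<Rightarrow> (nat \<Rightarrow> nat \<Rightarrow> int) \<Rightarrow> (nat \<times> nat) set" where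
  "newcomers n a = {(i, j). 1 \<le> j \<and> j \<le> i \<and> i < n \<and>
      a (i + 1) j > a i j \<and> a i j > a (i + 1) (j + 1)}"

definition sign_changing :: "nat \<Rightarrow> (nat \<Rightarrow> nat \<Rightarrow> int) \<Rightarrow> (nat \<times> nat) set" where
  "sign_changing n a = {(i, j). 1 \<le> j \<and> j + 1 \<le> i \<and> i < n \<and>
      a i j = a i (j + 1) \<and> a i (j + 1) = a (i + 1) (j + 1)}"

definition sc :: "nat \<Rightarrow> (nat \<Rightarrow> nat \<Rightarrow> int) \<Rightarrow> nat" where
  "sc n a = card (newcomers n a) + card (sign_changing n a)"

text \<open>Polynomials in n variables of degree at most n-1 in each variable, given by
  a coefficient function on exponent vectors (lists of length n with entries < n).\<close>
definition exps :: "nat \<Rightarrow> nat list set" where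
  "exps n = {e. length e = n \<and> (\<forall>i < n. e ! i < n)}"

definition poly_eval :: "nat \<Rightarrow> (nat list \<Rightarrow> rat) \<Rightarrow> int list \<Rightarrow> rat" where
  "poly_eval n c ks = (\<Sum>e\<in>exps n. c e * (\<Prod>i<n. (of_int (ks ! i)) ^ (e ! i)))"

definition strictly_incr :: "int list \<Rightarrow> bool" where
  "strictly_incr ks \<longleftrightarrow> (\<forall>i. i + 1 < length ks \<longrightarrow> ks ! i < ks ! (i + 1))"

text \<open>alpha n ks: value at ks of the unique polynomial (degree <= n-1 in each variable)
  which agrees with the number of Monotone Triangles on strictly increasing bottom rows.\<close>
definition alpha :: "nat \<Rightarrow> int list \<Rightarrow> rat" where
  "alpha n ks = (THE v. \<exists>c. (\<forall>ks'. length ks' = n \<and> strictly_incr ks' \<longrightarrow>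
        poly_eval n c ks' = of_nat (card (MT_set n ks'))) \<and> v = poly_eval n c ks)"

end

theory Submission
  imports Defs
begin

text \<open>
  Counting monotone triangles by the penultimate row gives a summation operator; reading each
  sum over an interval as a signed sum when the bounds are reversed extends the operator to
  arbitrary bottom rows (\<open>row_sum\<close>). Locally, its signed terms match conditions (1)--(3) and the
  signs of generalized monotone triangles, except on rows with three equal consecutive entries,
  on which the signed count vanishes anyway. So the signed count is obtained by iterating the operator.

  Applying the operator raises the degree in a variable bounding two summation ranges by two, in
  general. The functions \<open>h\<close> that occur here satisfy, in each pair of adjacent variables, that
  \<open>h x y - h x (y + 1) + h (x + 1) (y + 1)\<close> is antisymmetric. The operator preserves this
  property, and under it one of the two summations can be given a bound not depending on the
  variable, so that the degree grows by one only. Hence the signed count is a polynomial of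
  degree at most \<open>n - 1\<close> in each variable. It counts monotone triangles on strictly increasing
  rows, and such values determine the polynomial.
\<close>

section \<open>The summation operator\<close>

text \<open>The sum over the half-open interval from \<open>a\<close> to \<open>b\<close>, additive also for \<open>b < a\<close>
  (one of the two sums is always empty).\<close>

definition esum :: "int \<Rightarrow> int \<Rightarrow> (int \<Rightarrow> rat) \<Rightarrow> rat" where
  "esum a b g = sum g {a..<b} - sum g {b..<a}"

lemma esum_same [simp]: "esum a a g = 0"
  by (simp add: esum_def)

lemma esum_upper_Suc: "esum a (b + 1) g = esum a b g + g b"
proof (cases "a \<le> b")
  case True
  then have "{a..<b + 1} = insert b {a..<b}" by auto
  with True show ?thesis by (simp add: esum_def)
next
  case False
  then have "{b..<a} = insert b {b + 1..<a}" by auto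
  with False show ?thesis by (simp add: esum_def)
qed

lemma esum_lower_Suc: "esum (a + 1) b g = esum a b g - g a"
proof (cases "a < b")
  case True
  then have "{a..<b} = insert a {a + 1..<b}" by auto
  with True show ?thesis by (simp add: esum_def)
next
  case False
  then have "{b..<a + 1} = insert a {b..<a}" by auto
  with False show ?thesis by (simp add: esum_def)
qed

text \<open>Two-sided induction from \<open>a\<close>. Comparing increments avoids case distinctions
  on the order of summation bounds.\<close>

lemma int_fun_eqI:
  fixes f g :: "int \<Rightarrow> 'a::ab_group_add"
  assumes "f a = g a" and step: "\<And>x. f (x + 1) - f x = g (x + 1) - g x"
  shows "f x = g x"
proof (induction x rule: int_induct[where k = a])
  case (step1 i)
  then show ?case using step[of i] by simp
next
  case (step2 i)
  then show ?case using step[of "i - 1"] by simp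
qed (fact assms(1))

lemma esum_split: "esum a c g = esum a b g + esum b c g"
  by (rule int_fun_eqI[where a = b and f = "\<lambda>c. esum a c g"]) (simp_all add: esum_upper_Suc)

lemma esum_base_change: "esum a b g = esum c b g - esum c a g"
  by (simp add: esum_split[of c b g a])

lemma esum_add: "esum a b (\<lambda>l. f l + g l) = esum a b f + esum a b g"
  by (simp add: esum_def sum.distrib)

lemma esum_diff: "esum a b (\<lambda>l. f l - g l) = esum a b f - esum a b g"
  by (simp add: esum_def sum_subtractf)

lemma esum_cmult: "esum a b (\<lambda>l. c * f l) = c * esum a b f"
  by (simp add: esum_def sum_distrib_left right_diff_distrib)

lemma esum_zero [simp]: "esum a b (\<lambda>l. 0) = 0"
  by (simp add: esum_def)

lemma esum_shift: "esum a b (\<lambda>l. g (l + 1)) = esum (a + 1) (b + 1) g"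
proof (rule int_fun_eqI[where a = a and f = "\<lambda>b. esum a b (\<lambda>l. g (l + 1))"])
  fix b show "esum a (b + 1) (\<lambda>l. g (l + 1)) - esum a b (\<lambda>l. g (l + 1))
      = esum (a + 1) (b + 1 + 1) g - esum (a + 1) (b + 1) g"
    using esum_upper_Suc[of "a + 1" "b + 1" g] by (simp add: esum_upper_Suc)
qed simp

text \<open>In the last equation the first entry \<open>l\<close> of the row is either below \<open>k'\<close>, or it equals \<open>k'\<close>
  and forces the next entry to be at least \<open>k' + 1\<close>.\<close>

fun row_sum :: "(int list \<Rightarrow> rat) \<Rightarrow> int list \<Rightarrow> rat" where
  "row_sum f [] = 0"
| "row_sum f [k] = f []"
| "row_sum f (k # k' # ks) =
     esum k k' (\<lambda>l. row_sum (\<lambda>ls. f (l # ls)) (k' # ks)) + row_sum (\<lambda>ls. f (k' # ls)) ((k' + 1) # ks)"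

lemma row_sum_add: "row_sum (\<lambda>ls. f ls + g ls) ks = row_sum f ks + row_sum g ks"
  by (induction f ks arbitrary: g rule: row_sum.induct) (simp_all add: esum_add)

lemma row_sum_cmult: "row_sum (\<lambda>ls. c * f ls) ks = c * row_sum f ks"
  by (induction f ks rule: row_sum.induct) (simp_all add: esum_cmult distrib_left)

lemma row_sum_diff: "row_sum (\<lambda>ls. f ls - g ls) ks = row_sum f ks - row_sum g ks"
  using row_sum_add[of f "\<lambda>ls. (-1) * g ls" ks] row_sum_cmult[of "-1" g ks] by simp

lemma row_sum_zero [simp]: "row_sum (\<lambda>ls. 0) ks = 0"
  using row_sum_cmult[of 0 "\<lambda>ls. 0" ks] by simp

section \<open>Degree and shifted antisymmetry\<close>

text \<open>The \<open>d\<close>-th forward difference vanishes: on the integers this means being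
  polynomial of degree less than \<open>d\<close>.\<close>

fun diff_zero :: "nat \<Rightarrow> (int \<Rightarrow> rat) \<Rightarrow> bool" where
  "diff_zero 0 h \<longleftrightarrow> (\<forall>x. h x = 0)"
| "diff_zero (Suc d) h \<longleftrightarrow> diff_zero d (\<lambda>x. h (x + 1) - h x)"

lemma diff_zero_zero [simp]: "diff_zero d (\<lambda>x. 0)"
  by (induction d) simp_all

lemma diff_zero_const [simp]: "diff_zero (Suc d) (\<lambda>x. c)"
  by simp

lemma diff_zero_add: "diff_zero d f \<Longrightarrow> diff_zero d g \<Longrightarrow> diff_zero d (\<lambda>x. f x + g x)"
proof (induction d arbitrary: f g)
  case (Suc d)
  from Suc.IH[of "\<lambda>x. f (x + 1) - f x" "\<lambda>x. g (x + 1) - g x"] Suc.prems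
  show ?case by (simp add: algebra_simps)
qed simp

lemma diff_zero_cmult: "diff_zero d f \<Longrightarrow> diff_zero d (\<lambda>x. c * f x)"
proof (induction d arbitrary: f)
  case (Suc d)
  from Suc.IH[of "\<lambda>x. f (x + 1) - f x"] Suc.prems
  show ?case by (simp add: algebra_simps)
qed simp

lemma diff_zero_uminus: "diff_zero d f \<Longrightarrow> diff_zero d (\<lambda>x. - f x)"
  using diff_zero_cmult[of d f "-1"] by simp

lemma diff_zero_diff: "diff_zero d f \<Longrightarrow> diff_zero d g \<Longrightarrow> diff_zero d (\<lambda>x. f x - g x)"
  using diff_zero_add[of d f "\<lambda>x. - g x"] diff_zero_uminus[of d g] by simp

lemma diff_zero_Suc: "diff_zero d f \<Longrightarrow> diff_zero (Suc d) f"
proof (induction d arbitrary: f)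
  case (Suc d)
  then show ?case by (metis diff_zero.simps(2))
qed simp

lemma diff_zero_mono: "d \<le> e \<Longrightarrow> diff_zero d f \<Longrightarrow> diff_zero e f"
  by (induction e rule: dec_induct) (auto intro: diff_zero_Suc simp del: diff_zero.simps)

lemma diff_zero_shift: "diff_zero d f \<Longrightarrow> diff_zero d (\<lambda>x. f (x + 1))"
proof (induction d arbitrary: f)
  case (Suc d)
  from Suc.IH[of "\<lambda>x. f (x + 1) - f x"] Suc.prems show ?case by simp
qed simp

lemma diff_zero_sum:
  "(\<And>i. i \<in> I \<Longrightarrow> diff_zero d (f i)) \<Longrightarrow> diff_zero d (\<lambda>x. \<Sum>i\<in>I. f i x)"
  by (induction I rule: infinite_finite_induct) (simp_all add: diff_zero_add)

lemma diff_zero_esum: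
  "(\<And>l. diff_zero d (f l)) \<Longrightarrow> diff_zero d (\<lambda>x. esum a b (\<lambda>l. f l x))"
  unfolding esum_def by (intro diff_zero_diff diff_zero_sum)

lemma diff_zero_esum_upper: "diff_zero d g \<Longrightarrow> diff_zero (Suc d) (\<lambda>x. esum a x g)"
  by (simp add: esum_upper_Suc)

lemma diff_zero_esum_lower: "diff_zero d g \<Longrightarrow> diff_zero (Suc d) (\<lambda>x. esum x b g)"
  by (simp add: esum_lower_Suc diff_zero_uminus)

text \<open>\<open>row_sum\<close> is linear in \<open>f\<close>, so it commutes with differences in
  a parameter of \<open>f\<close>.\<close>

lemma diff_zero_row_sum:
  "(\<And>ls. diff_zero d (\<lambda>x. f x ls)) \<Longrightarrow> diff_zero d (\<lambda>x. row_sum (f x) ks)"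
proof (induction d arbitrary: f)
  case 0
  then have "f x = (\<lambda>ls. 0)" for x by auto
  then show ?case by simp
next
  case (Suc d)
  from Suc.IH[of "\<lambda>x ls. f (x + 1) ls - f x ls"] Suc.prems
  show ?case by (simp add: row_sum_diff)
qed

text \<open>In shift operators: the image of \<open>h\<close> under \<open>1 - E_y + E_x E_y\<close>
  is antisymmetric, hence zero on the diagonal.\<close>

definition shift_antisym :: "(int \<Rightarrow> int \<Rightarrow> rat) \<Rightarrow> bool" where
  "shift_antisym h \<longleftrightarrow> (\<forall>x y. h x y - h x (y + 1) + h (x + 1) (y + 1)
      + (h y x - h y (x + 1) + h (y + 1) (x + 1)) = 0)"

lemma shift_antisymD:
  "shift_antisym h \<Longrightarrow> h x y - h x (y + 1) + h (x + 1) (y + 1)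
      + (h y x - h y (x + 1) + h (y + 1) (x + 1)) = 0"
  by (simp add: shift_antisym_def)

lemma shift_antisym_zero [simp]: "shift_antisym (\<lambda>x y. 0)"
  by (simp add: shift_antisym_def)

lemma shift_antisym_add:
  "shift_antisym f \<Longrightarrow> shift_antisym g \<Longrightarrow> shift_antisym (\<lambda>x y. f x y + g x y)"
  unfolding shift_antisym_def
proof (intro allI, goal_cases)
  case (1 x y)
  from 1(1)[rule_format, of x y] 1(2)[rule_format, of x y] show ?case by simp
qed

lemma shift_antisym_uminus: "shift_antisym f \<Longrightarrow> shift_antisym (\<lambda>x y. - f x y)"
  unfolding shift_antisym_def
proof (intro allI, goal_cases)
  case (1 x y)
  from 1[rule_format, of x y] show ?case by simp
qed

lemma shift_antisym_sum:
  "(\<And>i. i \<in> I \<Longrightarrow> shift_antisym (f i)) \<Longrightarrow> shift_antisym (\<lambda>x y. \<Sum>i\<in>I. f i x y)"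
  by (induction I rule: infinite_finite_induct) (simp_all add: shift_antisym_add)

lemma shift_antisym_esum:
  assumes "\<And>l. shift_antisym (f l)"
  shows "shift_antisym (\<lambda>x y. esum a b (\<lambda>l. f l x y))"
  using shift_antisym_add[OF shift_antisym_sum[of "{a..<b}" f]
      shift_antisym_uminus[OF shift_antisym_sum[of "{b..<a}" f]]] assms
  by (simp add: esum_def)

lemma shift_antisym_row_sum:
  assumes "\<And>ls. shift_antisym (\<lambda>x y. f x y ls)"
  shows "shift_antisym (\<lambda>x y. row_sum (f x y) ks)"
  unfolding shift_antisym_def
proof (intro allI, goal_cases)
  case (1 x y)
  have "row_sum (\<lambda>ls. f x y ls - f x (y + 1) ls + f (x + 1) (y + 1) ls
      + (f y x ls - f y (x + 1) ls + f (y + 1) (x + 1) ls)) ks = 0"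
    using assms by (simp add: shift_antisym_def)
  then show ?case by (simp add: row_sum_add row_sum_diff)
qed

text \<open>The left-hand side is \<open>row_sum\<close> with bottom row \<open>a, x, b, \<dots>\<close>; on the right \<open>x\<close> bounds only one
  summation at a time.\<close>

lemma row_sum_reflect:
  fixes t :: "int \<Rightarrow> int \<Rightarrow> rat"
  assumes "shift_antisym t"
  shows "esum a x (\<lambda>l. esum x b (t l) + c l) + (esum (x + 1) b (t x) + c x)
    = esum a (x + 1) (\<lambda>l. esum a b (t l) + c l) - t x a - esum (a + 1) (x + 1) (t a)"
proof (rule int_fun_eqI[where a = a and x = x
      and f = "\<lambda>x. esum a x (\<lambda>l. esum x b (t l) + c l) + (esum (x + 1) b (t x) + c x)"])
  show "esum a a (\<lambda>l. esum a b (t l) + c l) + (esum (a + 1) b (t a) + c a)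
    = esum a (a + 1) (\<lambda>l. esum a b (t l) + c l) - t a a - esum (a + 1) (a + 1) (t a)"
    by (simp add: esum_upper_Suc esum_lower_Suc)
next
  fix x
  \<comment> \<open>The hypothesis summed over \<open>l\<close>. The sums of
    \<open>t l (x + 1)\<close> and of \<open>t x\<close> telescope, and the diagonal instance below
    handles the boundary terms at \<open>x\<close>.\<close>
  have "esum a x (\<lambda>l. t l x - t l (x + 1) + t (l + 1) (x + 1)
      + (t x l - t x (l + 1) + t (x + 1) (l + 1))) = 0"
    using assms by (simp add: shift_antisym_def)
  then have "esum a x (\<lambda>l. t l x) - esum a x (\<lambda>l. t l (x + 1)) + esum (a + 1) (x + 1) (\<lambda>l. t l (x + 1))
    + (esum a x (t x) - esum (a + 1) (x + 1) (t x) + esum (a + 1) (x + 1) (t (x + 1))) = 0"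
    using esum_shift[of a x "t x"] esum_shift[of a x "t (x + 1)"]
      esum_shift[of a x "\<lambda>l. t l (x + 1)"]
    by (simp add: esum_add esum_diff)
  moreover have "t x x - t x (x + 1) + t (x + 1) (x + 1) = 0"
    using shift_antisymD[OF assms, of x x] by simp
  moreover have "esum a (x + 1 + 1) (t (x + 1)) + esum (x + 1 + 1) b (t (x + 1)) = esum a b (t (x + 1))"
    by (simp add: esum_split[of a b _ "x + 1 + 1"])
  moreover have "esum a (2 + x) g = esum a x g + g x + g (x + 1)" for g
    using esum_upper_Suc[of a "x + 1" g] esum_upper_Suc[of a x g] by simp
  ultimately show "(esum a (x + 1) (\<lambda>l. esum (x + 1) b (t l) + c l) + (esum (x + 1 + 1) b (t (x + 1)) + c (x + 1)))
     - (esum a x (\<lambda>l. esum x b (t l) + c l) + (esum (x + 1) b (t x) + c x))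
    = (esum a (x + 1 + 1) (\<lambda>l. esum a b (t l) + c l) - t (x + 1) a - esum (a + 1) (x + 1 + 1) (t a))
     - (esum a (x + 1) (\<lambda>l. esum a b (t l) + c l) - t x a - esum (a + 1) (x + 1) (t a))"
    by (simp add: esum_upper_Suc esum_lower_Suc esum_add esum_diff)
qed

text \<open>A first entry bounds at most one summation, a second entry at most two, which
  \<open>row_sum_reflect\<close> separates. With a longer prefix the first summation does not
  involve \<open>x\<close>, and induction applies.\<close>

lemma diff_zero_row_sum_entry:
  assumes "\<And>us vs. shift_antisym (\<lambda>x y. f (us @ x # y # vs))"
    and "\<And>us vs. diff_zero d (\<lambda>x. f (us @ x # vs))"
  shows "diff_zero (Suc d) (\<lambda>x. row_sum f (us @ x # vs))"
  using assms
proof (induction "length us" arbitrary: us f rule: less_induct)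
  case less
  note AS = less.prems(1) and DZ = less.prems(2)
  have AS': "shift_antisym (\<lambda>x y. f (l # us @ x # y # vs))" for l us vs
    using AS[of "l # us" vs] by simp
  have DZ': "diff_zero d (\<lambda>x. f (l # us @ x # vs))" for l us vs
    using DZ[of "l # us" vs] by simp
  have DZ0: "diff_zero d (\<lambda>x. f (x # vs))" and DZ1: "diff_zero d (\<lambda>x. f (l # x # vs))" for l vs
    using DZ[of "[]" vs] DZ'[of l "[]" vs] by simp_all
  \<comment> \<open>The case rule of \<open>remdups_adj\<close> is borrowed for its split into lists
    with no, one, or at least two elements.\<close>
  consider "us = []" | a where "us = [a]" | a b us' where "us = a # b # us'"
    by (cases us rule: remdups_adj.cases) auto
  then show ?case
  proof cases
    case 1
    show ?thesis
    proof (cases vs)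
      case (Cons b vs')
      have "diff_zero (Suc d) (\<lambda>x. esum x b (\<lambda>l. row_sum (\<lambda>ls. f (l # ls)) (b # vs')) +
          row_sum (\<lambda>ls. f (b # ls)) ((b + 1) # vs'))"
        using DZ0 by (intro diff_zero_add diff_zero_esum_lower diff_zero_row_sum diff_zero_const)
      then show ?thesis by (simp only: 1 Cons append_Nil row_sum.simps)
    qed (simp add: 1)
  next
    case (2 a)
    show ?thesis
    proof (cases vs)
      case Nil
      have "diff_zero (Suc d) (\<lambda>x. esum a x (\<lambda>l. f [l]) + f [x])"
        by (intro diff_zero_add diff_zero_esum_upper diff_zero_Suc DZ0)
      then show ?thesis by (simp only: 2 Nil append.simps row_sum.simps)
    next
      case (Cons b vs')
      define t where "t l l' = row_sum (\<lambda>ls. f (l # l' # ls)) (b # vs')" for l l'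
      define c where "c l = row_sum (\<lambda>ls. f (l # b # ls)) ((b + 1) # vs')" for l
      have t: "shift_antisym t"
        using AS[of "[]"] unfolding t_def by (intro shift_antisym_row_sum) simp
      have dzt: "diff_zero d (\<lambda>x. t x l)" "diff_zero d (\<lambda>x. t l x)" for l
        unfolding t_def using DZ0 DZ1 by (intro diff_zero_row_sum; simp)+
      have dzc: "diff_zero d c"
        unfolding c_def using DZ0 by (intro diff_zero_row_sum)
      \<comment> \<open>In the reflected form both integrands have degree below \<open>d\<close> in
        the outer summation variable.\<close>
      have "diff_zero (Suc d) (\<lambda>x. esum a (x + 1) (\<lambda>l. esum a b (t l) + c l) - t x a
          - esum (a + 1) (x + 1) (t a))"
        by (intro diff_zero_diff diff_zero_shift[OF diff_zero_esum_upper] diff_zero_Suc[of d "\<lambda>x. t x a"]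
            diff_zero_add diff_zero_esum dzt dzc)
      then show ?thesis
        unfolding 2 Cons append.simps row_sum.simps
        unfolding t_def[symmetric] c_def[symmetric] row_sum_reflect[OF t] .
    qed
  next
    case (3 a b us')
    have IH: "diff_zero (Suc d) (\<lambda>x. row_sum (\<lambda>ls. f (l # ls)) ((k # us') @ x # vs))" for l k
      using AS' DZ' by (intro less.hyps) (simp_all add: 3)
    have "diff_zero (Suc d) (\<lambda>x. esum a b (\<lambda>l. row_sum (\<lambda>ls. f (l # ls)) ((b # us') @ x # vs)) +
          row_sum (\<lambda>ls. f (b # ls)) (((b + 1) # us') @ x # vs))"
      by (intro diff_zero_add diff_zero_esum IH)
    then show ?thesis
      by (simp only: 3 append.simps row_sum.simps)
  qed
qed

text \<open>Let \<open>t p q r\<close> be the contribution of rows with the entries \<open>p, q\<close> around the bottom entry \<open>x\<close>,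
  the bottom row continuing with \<open>r\<close>, and let \<open>- F\<close> be its antidifference in \<open>p\<close> and \<open>q\<close>. Then the
  function of \<open>x\<close> and \<open>y\<close> in the conclusion is \<open>row_sum\<close> with adjacent bottom entries \<open>x, y\<close>.
  In the proof, \<open>M\<close> arises by applying the shift operator \<open>1 - E\<^sub>j + E\<^sub>i E\<^sub>j\<close> to \<open>F\<close>
  for all three pairs \<open>i < j\<close> of variables; the operators for \<open>i < 3\<close> and \<open>j = 3\<close> together are
  symmetric in the first two variables, those for \<open>i = 1\<close> in the last two.\<close>

lemma shift_antisym_diagI:
  fixes F :: "int \<Rightarrow> int \<Rightarrow> int \<Rightarrow> rat"
  assumes 12: "\<And>r. shift_antisym (\<lambda>p q. F (p + 1) (q + 1) r - F (p + 1) q r - F p (q + 1) r + F p q r)"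
    and 23: "\<And>p. shift_antisym (\<lambda>q r. F p (q + 1) (r + 1) - F p (q + 1) r - F p q (r + 1) + F p q r)"
  shows "shift_antisym (\<lambda>x y.
      (F x x y - F x (x + 1) y + F (x + 1) (x + 1) y)
    - (F (x + 1) y y - F (x + 1) y (y + 1) + F (x + 1) (y + 1) (y + 1)))"
proof -
  \<comment> \<open>A vanishing mixed difference makes \<open>h\<close> a function of
    \<open>p\<close> plus a function of \<open>q\<close>, so the sums over opposite corners of a
    square on the diagonal agree.\<close>
  have rect: "h p q + h q p = h p p + h q q"
    if sym: "\<And>p q. h p q = h q p"
      and mixed: "\<And>p q. h (p + 1) (q + 1) - h (p + 1) q - h p (q + 1) + h p q = 0"
    for h :: "int \<Rightarrow> int \<Rightarrow> rat" and p q
  proof -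
    have *: "h p (s + 1) - h p s = h q (s + 1) - h q s" for s
      by (rule int_fun_eqI[where x = p and a = q and f = "\<lambda>p. h p (s + 1) - h p s"
            and g = "\<lambda>p. h q (s + 1) - h q s"]) (use mixed[of _ s] in \<open>simp_all add: algebra_simps\<close>)
    have "h p p - h q p = h p q - h q q"
      by (rule int_fun_eqI[where x = p and a = q and f = "\<lambda>s. h p s - h q s"
            and g = "\<lambda>s. h p q - h q q"]) (use * in \<open>simp_all add: algebra_simps\<close>)
    then show ?thesis using sym[of p q] by simp
  qed
  define U where "U p q r = F p q r - F p (q + 1) r + F (p + 1) (q + 1) r" for p q r
  define V where "V p q r = F p q r - F p q (r + 1) + F p (q + 1) (r + 1)" for p q r
  have U: "U p q r + U q p r = U p p r + U q q r" for p q r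
  proof -
    \<comment> \<open>\<open>rect\<close> is applied to the symmetrized \<open>U\<close>, hence the
      factor two on both sides.\<close>
    have "(U p q r + U q p r) + (U q p r + U p q r) = (U p p r + U p p r) + (U q q r + U q q r)"
    proof (rule rect[of "\<lambda>p q. U p q r + U q p r"])
      fix p q
      show "U (p + 1) (q + 1) r + U (q + 1) (p + 1) r - (U (p + 1) q r + U q (p + 1) r) -
          (U p (q + 1) r + U (q + 1) p r) + (U p q r + U q p r) = 0"
        using shift_antisymD[OF 12, of p q r] unfolding U_def by (simp add: algebra_simps)
    qed simp
    then show ?thesis by simp
  qed
  have V: "V p q r + V p r q = V p q q + V p r r" for p q r
  proof -
    have "(V p q r + V p r q) + (V p r q + V p q r) = (V p q q + V p q q) + (V p r r + V p r r)"
    proof (rule rect[of "\<lambda>q r. V p q r + V p r q"])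
      fix q r
      show "V p (q + 1) (r + 1) + V p (r + 1) (q + 1) - (V p (q + 1) r + V p r (q + 1)) -
          (V p q (r + 1) + V p (r + 1) q) + (V p q r + V p r q) = 0"
        using shift_antisymD[OF 23, of p q r] unfolding V_def by (simp add: algebra_simps)
    qed simp
    then show ?thesis by simp
  qed
  \<comment> \<open>\<open>d\<close> and \<open>e\<close> are the images under the shift operator of
    the two halves of the function in the conclusion, so the claim amounts to \<open>sym\<close>
    below.\<close>
  define d where "d x y = U x x y - U x x (y + 1) + U (x + 1) (x + 1) (y + 1)" for x y
  \<comment> \<open>On a function of the first two variables only, \<open>1 - E_3 + E_1 E_3\<close>
    reduces to the shift \<open>E_1\<close>; this explains the arguments
    \<open>x + 1\<close>.\<close>
  define e where "e x y = V (x + 1) y y - V (x + 1) (y + 1) (y + 1) + V (x + 1 + 1) (y + 1) (y + 1)" for x y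
  define W where "W h p q r = h p q r - h p q (r + 1) + h (p + 1) q (r + 1)" for h :: "int \<Rightarrow> int \<Rightarrow> int \<Rightarrow> rat" and p q r
  define M where "M p q r = W U p q r - W U p q (r + 1) + W U p (q + 1) (r + 1)" for p q r
  have M': "M p q r = W V p q r - W V p (q + 1) r + W V (p + 1) (q + 1) r" for p q r
    unfolding M_def W_def U_def V_def by (simp add: algebra_simps)
  \<comment> \<open>By \<open>U\<close>, the symmetrized argument is a function without
    \<open>q\<close> plus one without \<open>p\<close>. On the former
    \<open>1 - E_3 + E_2 E_3\<close> is the identity, likewise \<open>1 - E_3 + E_1 E_3\<close> on
    the latter.\<close>
  have Md: "M p q r + M q p r = d p r + d q r" for p q r
    using U[of p q r] U[of p q "r + 1"] U[of "p + 1" q "r + 1"] U[of p "q + 1" "r + 1"]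
      U[of p q "r + 1 + 1"] U[of "p + 1" q "r + 1 + 1"] U[of p "q + 1" "r + 1 + 1"]
      U[of "p + 1" "q + 1" "r + 1 + 1"]
    unfolding M_def W_def d_def by linarith
  have Me: "M p q r + M p r q = e p q + e p r" for p q r
    using V[of p q r] V[of p q "r + 1"] V[of "p + 1" q "r + 1"] V[of p "q + 1" r] V[of "p + 1" "q + 1" r]
      V[of p "q + 1" "r + 1"] V[of "p + 1" "q + 1" "r + 1"] V[of "p + 1 + 1" "q + 1" "r + 1"]
    unfolding M' W_def e_def by linarith
  \<comment> \<open>Repeated arguments give \<open>M x x y = d x y\<close>,
    \<open>M y x x = e y x\<close> and \<open>M x x x = d x x = e x x\<close>; the two relations
    that contain \<open>M x y x\<close> then eliminate it.\<close>
  have sym: "d x y + d y x = e x y + e y x" for x y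
    using Md[of x x y] Md[of x y x] Md[of y x x] Md[of y y x] Md[of x x x]
      Me[of x x y] Me[of x y x] Me[of y x x] Me[of x y y] Me[of x x x] by simp
  show ?thesis
    unfolding shift_antisym_def
    using sym unfolding d_def e_def U_def V_def by (simp add: algebra_simps)
qed

text \<open>\<open>shift_antisym_diagI\<close> treats the pair when at most one entry precedes it.
  Otherwise the bounds of the first summation are free of \<open>x\<close> and \<open>y\<close>, and
  induction applies.\<close>

lemma shift_antisym_row_sum_entries:
  assumes "\<And>us vs. shift_antisym (\<lambda>x y. f (us @ x # y # vs))"
  shows "shift_antisym (\<lambda>x y. row_sum f (us @ x # y # vs))"
  using assms
proof (induction "length us" arbitrary: us f rule: less_induct)
  case less
  note AS = less.prems(1)
  have AS': "shift_antisym (\<lambda>x y. f (l # us @ x # y # vs))" for l us vs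
    using AS[of "l # us" vs] by simp
  have AS0: "shift_antisym (\<lambda>x y. f (x # y # vs))" 
    and AS1: "shift_antisym (\<lambda>x y. f (l # x # y # vs))" for l vs
    using AS[of "[]" vs] AS'[of l "[]" vs] by simp_all
  consider "us = []" | a where "us = [a]" | a b us' where "us = a # b # us'"
    by (cases us rule: remdups_adj.cases) auto
  then show ?case
  proof cases
    case 1
    define t where "t l r = row_sum (\<lambda>ls. f (l # ls)) (r # vs)" for l r
    \<comment> \<open>No row entry lies left of \<open>x\<close>. With a dummy argument
      \<open>p\<close>, the mixed difference in the first premise of
      \<open>shift_antisym_diagI\<close> is zero.\<close>
    define F where "F p q r = - esum 0 q (\<lambda>l. t l r)" for p q r :: int
    have "shift_antisym (\<lambda>q r. t q (r + 1) - t q r)"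
    proof (cases vs)
      case (Cons b vs')
      \<comment> \<open>Raising the bottom entry \<open>r\<close> drops the summand in which the row
        entry after \<open>q\<close> is \<open>r\<close>.\<close>
      have "t q (r + 1) - t q r = - row_sum (\<lambda>ls. f (q # r # ls)) (b # vs')" for q r
        by (simp add: t_def Cons esum_lower_Suc)
      moreover have "shift_antisym (\<lambda>q r. row_sum (\<lambda>ls. f (q # r # ls)) (b # vs'))"
        by (intro shift_antisym_row_sum AS0)
      ultimately show ?thesis by (simp add: shift_antisym_uminus)
    qed (simp add: t_def)
    from shift_antisym_uminus[OF this]
    have "shift_antisym (\<lambda>q r. F p (q + 1) (r + 1) - F p (q + 1) r - F p q (r + 1) + F p q r)" for p
      by (simp add: F_def esum_upper_Suc)
    from shift_antisym_diagI[OF _ this]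
    have "shift_antisym (\<lambda>x y. (F x x y - F x (x + 1) y + F (x + 1) (x + 1) y)
        - (F (x + 1) y y - F (x + 1) y (y + 1) + F (x + 1) (y + 1) (y + 1)))"
      by (simp add: F_def)
    moreover have "row_sum f (x # y # vs) = (F x x y - F x (x + 1) y + F (x + 1) (x + 1) y)
        - (F (x + 1) y y - F (x + 1) y (y + 1) + F (x + 1) (y + 1) (y + 1))" for x y
      unfolding row_sum.simps t_def[symmetric]
      by (simp add: F_def esum_upper_Suc esum_base_change[of x y _ 0])
    ultimately show ?thesis using 1 by simp
  next
    case (2 a)
    define t where "t k l r = row_sum (\<lambda>ls. f (k # l # ls)) (r # vs)" for k l r
    \<comment> \<open>The base \<open>a\<close> for \<open>p\<close> is the lower bound of the first
      summation; the base 0 for \<open>q\<close> is arbitrary and cancels through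
      \<open>esum_base_change\<close>.\<close>
    define F where "F p q r = - esum a p (\<lambda>k. esum 0 q (\<lambda>l. t k l r))" for p q r :: int
    have "shift_antisym (\<lambda>q r. t k q (r + 1) - t k q r)" for k
    proof (cases vs)
      case (Cons b vs')
      have "t k q (r + 1) - t k q r = - row_sum (\<lambda>ls. f (k # q # r # ls)) (b # vs')" for q r
        by (simp add: t_def Cons esum_lower_Suc)
      moreover have "shift_antisym (\<lambda>q r. row_sum (\<lambda>ls. f (k # q # r # ls)) (b # vs'))"
        by (intro shift_antisym_row_sum AS1)
      ultimately show ?thesis by (simp add: shift_antisym_uminus)
    qed (simp add: t_def)
    from shift_antisym_uminus[OF shift_antisym_esum, OF this]
    have 23: "shift_antisym (\<lambda>q r. F p (q + 1) (r + 1) - F p (q + 1) r - F p q (r + 1) + F p q r)" for p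
      by (simp add: F_def esum_upper_Suc esum_add esum_diff)
    have "shift_antisym (\<lambda>p q. - t p q r)" for r
      unfolding t_def by (intro shift_antisym_uminus shift_antisym_row_sum AS0)
    then have 12: "shift_antisym (\<lambda>p q. F (p + 1) (q + 1) r - F (p + 1) q r - F p (q + 1) r + F p q r)" for r
      by (simp add: F_def esum_upper_Suc esum_add)
    have "row_sum f (a # x # y # vs) = (F x x y - F x (x + 1) y + F (x + 1) (x + 1) y)
        - (F (x + 1) y y - F (x + 1) y (y + 1) + F (x + 1) (y + 1) (y + 1))" for x y
      unfolding row_sum.simps t_def[symmetric]
      by (simp add: F_def esum_upper_Suc esum_lower_Suc esum_add esum_diff esum_base_change[of x y _ 0])
    with shift_antisym_diagI[OF 12 23] show ?thesis using 2 by simp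
  next
    case (3 a b us')
    have IH: "shift_antisym (\<lambda>x y. row_sum (\<lambda>ls. f (l # ls)) ((k # us') @ x # y # vs))" for l k
      using AS' by (intro less.hyps) (simp_all add: 3)
    have "shift_antisym (\<lambda>x y. esum a b (\<lambda>l. row_sum (\<lambda>ls. f (l # ls)) ((b # us') @ x # y # vs)) +
          row_sum (\<lambda>ls. f (b # ls)) (((b + 1) # us') @ x # y # vs))"
      by (intro shift_antisym_add shift_antisym_esum IH)
    then show ?thesis
      by (simp only: 3 append.simps row_sum.simps)
  qed
qed

section \<open>Rows of generalized monotone triangles\<close>

text \<open>Local factors of the signed indicator of a row: \<open>entry_wt\<close> carries (1) and
  the sign of a newcomer, \<open>pair_wt\<close> carries (2), (3) and the sign of a sign-changing
  pair, while \<open>first_wt\<close> and \<open>last_wt\<close> exclude the cases of (3) whose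
  required neighbour is missing.\<close>

definition entry_wt :: "int \<Rightarrow> int \<Rightarrow> int \<Rightarrow> rat" where
  "entry_wt k k' l = (if min k k' \<le> l \<and> l \<le> max k k' then if k > l \<and> l > k' then -1 else 1 else 0)"

definition pair_wt :: "int \<Rightarrow> int \<Rightarrow> int \<Rightarrow> int \<Rightarrow> int \<Rightarrow> rat" where
  "pair_wt k0 k k' l0 l =
    (if (k0 \<le> k \<and> k \<le> k' \<longrightarrow> l0 < l) \<and> (l = k \<and> k > k' \<longrightarrow> l0 = l) \<and> (k0 > k \<and> k = l0 \<longrightarrow> l = l0)
     then if l0 = l \<and> l = k then -1 else 1 else 0)"

definition first_wt :: "int \<Rightarrow> int \<Rightarrow> int \<Rightarrow> rat" where
  "first_wt k k' l = (if l = k \<and> k > k' then 0 else 1)"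

definition last_wt :: "int \<Rightarrow> int \<Rightarrow> int \<Rightarrow> rat" where
  "last_wt k0 k l0 = (if k0 > k \<and> k = l0 then 0 else 1)"

text \<open>The optional pair holds the bottom entry and the row entry immediately to the left.\<close>

fun row_wt :: "(int \<times> int) option \<Rightarrow> int list \<Rightarrow> int list \<Rightarrow> rat" where
  "row_wt None [k] [] = 1"
| "row_wt (Some (k0, l0)) [k] [] = last_wt k0 k l0"
| "row_wt None (k # k' # ks) (l # ls) =
     first_wt k k' l * entry_wt k k' l * row_wt (Some (k, l)) (k' # ks) ls"
| "row_wt (Some (k0, l0)) (k # k' # ks) (l # ls) =
     pair_wt k0 k k' l0 l * entry_wt k k' l * row_wt (Some (k, l)) (k' # ks) ls"
| "row_wt _ _ _ = 0"

fun rows :: "int list \<Rightarrow> int list set" where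
  "rows (k # k' # ks) = (\<lambda>(l, ls). l # ls) ` ({min k k'..max k k'} \<times> rows (k' # ks))"
| "rows _ = {[]}"

lemma finite_rows [simp]: "finite (rows ks)"
  by (induction ks rule: rows.induct) simp_all

definition weighted_sum :: "(int \<times> int) option \<Rightarrow> (int list \<Rightarrow> rat) \<Rightarrow> int list \<Rightarrow> rat" where
  "weighted_sum p f ks = (\<Sum>ls\<in>rows ks. row_wt p ks ls * f ls)"

lemma weighted_sum_single [simp]:
  "weighted_sum None f [k] = f []"
  "weighted_sum (Some (k0, l0)) f [k] = last_wt k0 k l0 * f []"
  by (simp_all add: weighted_sum_def)

lemma sum_rows_Cons:
  "(\<Sum>ls\<in>rows (k # k' # ks). g ls) = (\<Sum>l\<in>{min k k'..max k k'}. \<Sum>ls\<in>rows (k' # ks). g (l # ls))"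
  by (simp add: sum.reindex inj_on_def sum.cartesian_product case_prod_unfold)

lemma weighted_sum_Cons:
  "weighted_sum None f (k # k' # ks) = (\<Sum>l\<in>{min k k'..max k k'}.
     first_wt k k' l * entry_wt k k' l * weighted_sum (Some (k, l)) (\<lambda>ls. f (l # ls)) (k' # ks))"
  "weighted_sum (Some (k0, l0)) f (k # k' # ks) = (\<Sum>l\<in>{min k k'..max k k'}.
     pair_wt k0 k k' l0 l * entry_wt k k' l * weighted_sum (Some (k, l)) (\<lambda>ls. f (l # ls)) (k' # ks))"
  unfolding weighted_sum_def sum_rows_Cons by (simp_all add: sum_distrib_left mult.assoc)

text \<open>Raising \<open>k\<close> drops at most the summand with first row entry
  \<open>k\<close>, which is zero.\<close>

lemma row_sum_Suc_eq:
  assumes "\<And>vs. f (k # vs) = 0"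
  shows "row_sum f ((k + 1) # ks) = row_sum f (k # ks)"
  using assms by (cases ks) (simp_all add: esum_lower_Suc)

text \<open>The three cases record how the previous row entry relates to the bottom entry \<open>k\<close>: it differs
  from \<open>k\<close>, or it equals \<open>k\<close> and \<open>k\<close> ends an ascent or a descent of the bottom row.\<close>

lemma weighted_sum_eq_row_sum:
  assumes "\<And>us x vs. f (us @ x # x # x # vs) = 0"
  shows "p = None \<or> (\<exists>k0 l0. p = Some (k0, l0) \<and> l0 \<noteq> k \<and> (k0 \<le> k \<longrightarrow> l0 < k)) \<Longrightarrow>
      weighted_sum p f (k # ks) = row_sum f (k # ks)"
    and "\<lbrakk>k0 \<le> k; \<And>vs. f (k # k # vs) = 0\<rbrakk> \<Longrightarrow>
      weighted_sum (Some (k0, k)) f (k # ks) = row_sum f ((k + 1) # ks)"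
    and "\<lbrakk>k0 > k; \<And>vs. f (k # k # vs) = 0\<rbrakk> \<Longrightarrow>
      weighted_sum (Some (k0, k)) f (k # ks) = row_sum f ((k + 1) # ks) - row_sum f (k # ks)"
  using assms
proof (induction ks arbitrary: k k0 f p)
  case Nil
  {
    case 1
    then show ?case by (auto simp: last_wt_def)
  next
    case 2
    then show ?case by (simp add: last_wt_def)
  next
    case 3
    then show ?case by (simp add: last_wt_def)
  }
next
  case (Cons k' ks)
  define S where "S = (\<lambda>(f :: int list \<Rightarrow> rat) l. row_sum (\<lambda>ls. f (l # ls)) (k' # ks))"
  define S' where "S' f = row_sum (\<lambda>ls. f (k' # ls)) ((k' + 1) # ks)" for f :: "int list \<Rightarrow> rat"
  have rs: "row_sum f (k # k' # ks) = esum k k' (S f) + S' f" for f k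
    by (simp add: S_def S'_def)
  \<comment> \<open>The induction hypotheses for the tail. If \<open>l = k'\<close>, the vanishing
    on triples supplies their premise about two further entries \<open>k'\<close>.\<close>
  have W: "weighted_sum (Some (k, l)) (\<lambda>ls. f (l # ls)) (k' # ks)
      = (if l \<noteq> k' then S f l else if k \<le> k' then S' f else S' f - S f k')"
    if "\<And>us x vs. f (us @ x # x # x # vs) = 0" "min k k' \<le> l" "l \<le> max k k'" for f k l
  proof -
    have "f (l # us @ x # x # x # vs) = 0" for us x vs
      using that(1)[of "l # us"] by simp
    moreover have "f (l # l # l # vs) = 0" for vs
      using that(1)[of "[]"] by simp
    ultimately show ?thesis
      using Cons.IH[where f = "\<lambda>ls. f (l # ls)" and k = k'] that(2,3) by (auto simp: S_def S'_def)
  qed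
  have asc: "{min k k'..max k k'} = insert k' {k..<k'}" "k' \<notin> {k..<k'}" if "k \<le> k'" for k
    using that by auto
  have desc: "{min k k'..max k k'} = insert k' (insert k {k'<..<k})" "k' \<notin> insert k {k'<..<k}" "k \<notin> {k'<..<k}"
     "{k'..<k} = insert k' {k'<..<k}" if "k' < k" for k
    using that by auto
  {
    case 1
    have w: "weighted_sum p f (k # k' # ks) = (\<Sum>l\<in>{min k k'..max k k'}.
        first_wt k k' l * entry_wt k k' l * (if l \<noteq> k' then S f l else if k \<le> k' then S' f else S' f - S f k'))"
      (is "_ = ?R")
    proof (cases p)
      case None
      then show ?thesis using 1(2) by (auto simp: weighted_sum_Cons W intro!: sum.cong)
    next
      case (Some a)
      then obtain k0 l0 where p: "p = Some (k0, l0)" "l0 \<noteq> k" "k0 \<le> k \<longrightarrow> l0 < k" using 1(1) by auto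
      then have "pair_wt k0 k k' l0 l = first_wt k k' l" if "l \<in> {min k k'..max k k'}" for l
        using that by (auto simp: pair_wt_def first_wt_def)
      then show ?thesis using 1(2) p(1) by (auto simp: weighted_sum_Cons W intro!: sum.cong)
    qed
    show ?case
    proof (cases "k \<le> k'")
      case True
      then have "?R = (\<Sum>l\<in>{k..<k'}. S f l) + S' f"
        unfolding asc[OF True] by (subst sum.insert) (auto simp: first_wt_def entry_wt_def intro!: sum.cong)
      with True show ?thesis unfolding w rs by (simp add: esum_def)
    next
      case False
      \<comment> \<open>On a descent \<open>l = k\<close> has weight zero, newcomers are negative,
        and \<open>- S f k'\<close> supplies the missing end of the reversed sum over
        \<open>{k'..<k}\<close>.\<close>
      then have "?R = - (\<Sum>l\<in>{k'<..<k}. S f l) + (S' f - S f k')"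
        using desc[of k] by (simp add: first_wt_def entry_wt_def sum_negf[symmetric])
      with False show ?thesis unfolding w rs using desc(4)[of k] by (simp add: esum_def)
    qed
  next
    case 2
    have w: "weighted_sum (Some (k0, k)) f (k # k' # ks) = (\<Sum>l\<in>{min k k'..max k k'}.
        pair_wt k0 k k' k l * entry_wt k k' l * (if l \<noteq> k' then S f l else if k \<le> k' then S' f else S' f - S f k'))"
      (is "_ = ?R")
      using 2(3) by (auto simp: weighted_sum_Cons W intro!: sum.cong)
    consider "k < k'" | "k = k'" | "k' < k" by linarith
    then show ?case
    proof cases
      case 1
      then have "{k..<k'} = insert k {k + 1..<k'}" by auto
      then have "?R = (\<Sum>l\<in>{k + 1..<k'}. S f l) + S' f"
        using asc[of k] 1 2(1) by (simp add: pair_wt_def entry_wt_def)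
      with 1 \<open>{k..<k'} = _\<close> show ?thesis unfolding w rs by (simp add: esum_def esum_lower_Suc)
    next
      case eq: 2
      \<comment> \<open>Here (2) leaves no row, and correspondingly the right-hand side
        \<open>S' f - S f k'\<close> vanishes.\<close>
      have "S' f = S f k'"
        unfolding S_def S'_def using 2(2) eq by (intro row_sum_Suc_eq) simp
      then show ?thesis unfolding w rs using eq 2(1) by (simp add: esum_lower_Suc pair_wt_def)
    next
      case 3
      then have "?R = - (\<Sum>l\<in>{k'<..<k}. S f l) - S f k + (S' f - S f k')"
        using desc[of k] 2(1) by (simp add: pair_wt_def entry_wt_def sum_negf[symmetric])
      with 3 show ?thesis unfolding w rs esum_lower_Suc using desc(4)[of k] by (simp add: esum_def)
    qed
  next
    case 3
    have w: "weighted_sum (Some (k0, k)) f (k # k' # ks) = (\<Sum>l\<in>{min k k'..max k k'}.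
        pair_wt k0 k k' k l * entry_wt k k' l * (if l \<noteq> k' then S f l else if k \<le> k' then S' f else S' f - S f k'))"
      (is "_ = ?R")
      using 3(3) by (auto simp: weighted_sum_Cons W intro!: sum.cong)
    \<comment> \<open>By (3) only \<open>l = k\<close> survives, forming a sign-changing pair with
      the previous entry.\<close>
    also have "\<dots> = (\<Sum>l\<in>{min k k'..max k k'}. if l = k then - (if k \<noteq> k' then S f k else S' f) else 0)"
      using 3(1) by (intro sum.cong) (auto simp: pair_wt_def entry_wt_def)
    also have "\<dots> = - (if k \<noteq> k' then S f k else S' f)"
      by simp
    finally have w: "weighted_sum (Some (k0, k)) f (k # k' # ks) = \<dots>" .
    have "S' f = S f k'" if "k = k'"
      unfolding S_def S'_def using 3(2) that by (intro row_sum_Suc_eq) simp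
    then show ?case unfolding w rs by (simp add: esum_lower_Suc)
  }
qed

lemma sign_if_nonzero_iff: "(if C then if D then -1 else 1 else 0) \<noteq> (0 :: rat) \<longleftrightarrow> C"
  by simp

lemma entry_wt_nonzero_iff: "entry_wt k k' l \<noteq> 0 \<longleftrightarrow> min k k' \<le> l \<and> l \<le> max k k'"
  unfolding entry_wt_def by (rule sign_if_nonzero_iff)

lemma pair_wt_nonzero_iff:
  "pair_wt k0 k k' l0 l \<noteq> 0 \<longleftrightarrow> (k0 \<le> k \<and> k \<le> k' \<longrightarrow> l0 < l)
    \<and> (l = k \<and> k > k' \<longrightarrow> l0 = l) \<and> (k0 > k \<and> k = l0 \<longrightarrow> l = l0)"
  unfolding pair_wt_def by (rule sign_if_nonzero_iff)

lemma entry_wt_sign: "entry_wt k k' l \<noteq> 0 \<Longrightarrow> entry_wt k k' l = (if k > l \<and> l > k' then -1 else 1)"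
  by (drule entry_wt_nonzero_iff[THEN iffD1]) (unfold entry_wt_def, rule if_P)

lemma pair_wt_sign: "pair_wt k0 k k' l0 l \<noteq> 0 \<Longrightarrow> pair_wt k0 k k' l0 l = (if l0 = l \<and> l = k then -1 else 1)"
  by (drule pair_wt_nonzero_iff[THEN iffD1]) (unfold pair_wt_def, rule if_P)

lemma row_wt_rows: "row_wt p ks ls \<noteq> 0 \<Longrightarrow> ls \<in> rows ks"
proof (induction p ks ls rule: row_wt.induct)
  case (3 k k' ks l ls)
  then show ?case by (auto simp: entry_wt_def split: if_splits)
next
  case (4 k0 l0 k k' ks l ls)
  then show ?case by (auto simp: entry_wt_def split: if_splits)
qed auto

text \<open>\<open>row_wt\<close> without \<open>first_wt\<close>, in product form, so that
  conditions at all positions can be read off the factors.\<close>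

definition body_wt :: "int list \<Rightarrow> int list \<Rightarrow> rat" where
  "body_wt ks ls = (\<Prod>j<length ls. entry_wt (ks ! j) (ks ! Suc j) (ls ! j))
     * (\<Prod>j<length ls - 1. pair_wt (ks ! j) (ks ! Suc j) (ks ! Suc (Suc j)) (ls ! j) (ls ! Suc j))
     * last_wt (ks ! (length ls - 1)) (ks ! length ls) (ls ! (length ls - 1))"

lemma row_wt_Some_eq_body_wt:
  "length ks = length ls \<Longrightarrow>
    entry_wt k0 k l0 * row_wt (Some (k0, l0)) (k # ks) ls = body_wt (k0 # k # ks) (l0 # ls)"
proof (induction ls arbitrary: k0 k l0 ks)
  case Nil
  then show ?case by (simp add: body_wt_def)
next
  case (Cons l ls)
  then obtain k' ks' where ks: "ks = k' # ks'" "length ks' = length ls" by (cases ks) auto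
  have "body_wt (k0 # k # ks) (l0 # l # ls) = entry_wt k0 k l0 * pair_wt k0 k k' l0 l * body_wt (k # ks) (l # ls)"
    unfolding body_wt_def ks by (simp add: prod.lessThan_Suc_shift del: prod.lessThan_Suc)
  with Cons.IH[OF ks(2), of k k' l] show ?case by (simp add: ks)
qed

section \<open>Conditions (1)-(3) and signs between two consecutive rows\<close>

definition gmt_row :: "nat \<Rightarrow> (nat \<Rightarrow> int) \<Rightarrow> (nat \<Rightarrow> int) \<Rightarrow> bool" where
  "gmt_row i b r \<longleftrightarrow>
     (\<forall>j. 1 \<le> j \<and> j \<le> i \<longrightarrow> min (b j) (b (j + 1)) \<le> r j \<and> r j \<le> max (b j) (b (j + 1))) \<and>
     (\<forall>j. 1 \<le> j \<and> j + 1 \<le> i \<longrightarrow> b j \<le> b (j + 1) \<and> b (j + 1) \<le> b (j + 2) \<longrightarrow> r j < r (j + 1)) \<and>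
     (\<forall>j. 1 \<le> j \<and> j \<le> i \<longrightarrow>
        (r j = b j \<and> b j > b (j + 1) \<longrightarrow> 2 \<le> j \<and> r (j - 1) = r j) \<and>
        (b j > b (j + 1) \<and> b (j + 1) = r j \<longrightarrow> j + 1 \<le> i \<and> r (j + 1) = r j))"

lemma GMT_iff_gmt_row: "GMT n a \<longleftrightarrow> tri_ext n a \<and> (\<forall>i<n. gmt_row i (a (i + 1)) (a i))"
  unfolding GMT_def gmt_row_def by blast

definition row_sc :: "nat \<Rightarrow> (nat \<Rightarrow> int) \<Rightarrow> (nat \<Rightarrow> int) \<Rightarrow> nat" where
  "row_sc i b r = card {j. 1 \<le> j \<and> j \<le> i \<and> b j > r j \<and> r j > b (j + 1)}
     + card {j. 1 \<le> j \<and> j + 1 \<le> i \<and> r j = r (j + 1) \<and> r (j + 1) = b (j + 1)}"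

lemma sc_eq_sum_row_sc: "sc n a = (\<Sum>i<n. row_sc i (a (i + 1)) (a i))"
proof -
  have "newcomers n a = Sigma {..<n} (\<lambda>i. {j. 1 \<le> j \<and> j \<le> i \<and> a (i + 1) j > a i j \<and> a i j > a (i + 1) (j + 1)})"
    by (auto simp: newcomers_def)
  moreover have "sign_changing n a = Sigma {..<n} (\<lambda>i. {j. 1 \<le> j \<and> j + 1 \<le> i \<and> a i j = a i (j + 1) \<and> a i (j + 1) = a (i + 1) (j + 1)})"
    by (auto simp: sign_changing_def)
  moreover have "finite {j. 1 \<le> j \<and> j \<le> i \<and> P j}" "finite {j. 1 \<le> j \<and> j + 1 \<le> i \<and> P j}" for i :: nat and P
    by (rule finite_subset[of _ "{..i}"]; auto)+
  ultimately show ?thesis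
    by (simp add: sc_def row_sc_def sum.distrib)
qed

lemma power_card_eq_prod:
  "finite S \<Longrightarrow> (-1 :: rat) ^ card {x\<in>S. P x} = (\<Prod>x\<in>S. if P x then -1 else 1)"
  by (simp add: prod.If_cases Int_def)

text \<open>In the product form, nonvanishing of the factors is (1)-(3), and the factors -1 count
  newcomers and sign-changing pairs. List positions start at 0, triangle positions at 1.\<close>

lemma row_wt_None_eq:
  assumes len: "length ks = Suc (length ls)"
    and b: "\<And>j. j \<le> length ls \<Longrightarrow> b (Suc j) = ks ! j"
    and r: "\<And>j. j < length ls \<Longrightarrow> r (Suc j) = ls ! j"
  shows "row_wt None ks ls = (if gmt_row (length ls) b r then (-1) ^ row_sc (length ls) b r else 0)"
proof (cases ls)
  case Nil
  with len obtain k where "ks = [k]" by (cases ks) auto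
  have "gmt_row 0 b r" by (auto simp: gmt_row_def)
  moreover have "row_sc 0 b r = 0" by (simp add: row_sc_def)
  ultimately show ?thesis using Nil \<open>ks = [k]\<close> by simp
next
  case (Cons l ls')
  define m where "m = length ls"
  have m: "m = Suc (length ls')" by (simp add: m_def Cons)
  obtain k k' ks' where ks: "ks = k # k' # ks'" "length ks' = length ls'"
    using len Cons by (cases ks; cases "tl ks") auto
  have wt: "row_wt None ks ls = first_wt (ks ! 0) (ks ! 1) (ls ! 0) * body_wt ks ls"
    using row_wt_Some_eq_body_wt[OF ks(2), of k k' l] by (simp add: ks Cons mult.assoc)
  define E where "E j = entry_wt (b (Suc j)) (b (Suc (Suc j))) (r (Suc j))" for j
  define Q where "Q j = pair_wt (b (Suc j)) (b (Suc (Suc j))) (b (Suc (Suc (Suc j)))) (r (Suc j)) (r (Suc (Suc j)))" for j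
  have wt': "row_wt None ks ls = first_wt (b 1) (b 2) (r 1) * (\<Prod>j<m. E j) * (\<Prod>j<m - 1. Q j) * last_wt (b m) (b (Suc m)) (r m)"
    using b r m unfolding wt body_wt_def m_def[symmetric] E_def Q_def
    by (simp add: numeral_2_eq_2)
  have nz: "row_wt None ks ls \<noteq> 0 \<longleftrightarrow> first_wt (b 1) (b 2) (r 1) \<noteq> 0 \<and> (\<forall>j<m. E j \<noteq> 0)
      \<and> (\<forall>j<m - 1. Q j \<noteq> 0) \<and> last_wt (b m) (b (Suc m)) (r m) \<noteq> 0"
    unfolding wt' by auto
  have iff: "gmt_row m b r \<longleftrightarrow> row_wt None ks ls \<noteq> 0"
  proof
    assume g: "gmt_row m b r"
    note c1 = g[unfolded gmt_row_def, THEN conjunct1, rule_format]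
    note c2 = g[unfolded gmt_row_def, THEN conjunct2, THEN conjunct1, rule_format]
    note c3 = g[unfolded gmt_row_def, THEN conjunct2, THEN conjunct2, rule_format]
    have "first_wt (b 1) (b 2) (r 1) \<noteq> 0"
      using c3[of 1] m by (auto simp: first_wt_def numeral_2_eq_2)
    moreover have "last_wt (b m) (b (Suc m)) (r m) \<noteq> 0"
      using c3[of m] m by (auto simp: last_wt_def)
    moreover have "E j \<noteq> 0" if "j < m" for j
      using c1[of "Suc j"] that by (auto simp: E_def entry_wt_def)
    moreover have "Q j \<noteq> 0" if "j < m - 1" for j
      unfolding Q_def pair_wt_nonzero_iff
    proof (intro conjI impI; elim conjE)
      show "r (Suc j) < r (Suc (Suc j))"
        if "b (Suc j) \<le> b (Suc (Suc j))" "b (Suc (Suc j)) \<le> b (Suc (Suc (Suc j)))"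
        using c2[of "Suc j"] that \<open>j < m - 1\<close> by simp
      show "r (Suc j) = r (Suc (Suc j))"
        if "r (Suc (Suc j)) = b (Suc (Suc j))" "b (Suc (Suc (Suc j))) < b (Suc (Suc j))"
        using c3[of "Suc (Suc j)"] that \<open>j < m - 1\<close> by simp
      show "r (Suc (Suc j)) = r (Suc j)"
        if "b (Suc (Suc j)) < b (Suc j)" "b (Suc (Suc j)) = r (Suc j)"
        using c3[of "Suc j"] that \<open>j < m - 1\<close> by simp
    qed
    ultimately show "row_wt None ks ls \<noteq> 0"
      unfolding nz by blast
  next
    assume "row_wt None ks ls \<noteq> 0"
    then have F: "first_wt (b 1) (b 2) (r 1) \<noteq> 0" and L: "last_wt (b m) (b (Suc m)) (r m) \<noteq> 0"
      and E: "\<And>j. j < m \<Longrightarrow> E j \<noteq> 0" and Q: "\<And>j. j < m - 1 \<Longrightarrow> Q j \<noteq> 0"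
      unfolding nz by blast+
    show "gmt_row m b r"
      unfolding gmt_row_def
    proof (intro conjI allI impI; elim conjE)
      fix j assume "1 \<le> j" "j \<le> m"
      with E[of "j - 1"] show "min (b j) (b (j + 1)) \<le> r j" "r j \<le> max (b j) (b (j + 1))"
        by (simp_all add: E_def entry_wt_nonzero_iff)
    next
      fix j assume "1 \<le> j" "j + 1 \<le> m" "b j \<le> b (j + 1)" "b (j + 1) \<le> b (j + 2)"
      with Q[of "j - 1"] show "r j < r (j + 1)"
        by (simp add: Q_def pair_wt_nonzero_iff)
    next
      fix j assume j: "1 \<le> j" "j \<le> m" and *: "r j = b j" "b (j + 1) < b j"
      show "2 \<le> j"
        using F j * by (cases "j = 1") (auto simp: first_wt_def numeral_2_eq_2)
      then obtain i where "j = Suc (Suc i)" by (metis Suc_le_D numeral_2_eq_2 Suc_le_mono)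
      with Q[of i] j * show "r (j - 1) = r j"
        by (simp add: Q_def pair_wt_nonzero_iff)
    next
      fix j assume j: "1 \<le> j" "j \<le> m" and *: "b (j + 1) < b j" "b (j + 1) = r j"
      show "j + 1 \<le> m"
        using L j * by (cases "j = m") (auto simp: last_wt_def)
      with Q[of "j - 1"] j * show "r (j + 1) = r j"
        by (simp add: Q_def pair_wt_nonzero_iff)
    qed
  qed
  have "row_wt None ks ls = (-1) ^ row_sc m b r" if g: "gmt_row m b r"
  proof -
    have n: "first_wt (b 1) (b 2) (r 1) \<noteq> 0" "last_wt (b m) (b (Suc m)) (r m) \<noteq> 0"
      "\<And>j. j < m \<Longrightarrow> E j \<noteq> 0" "\<And>j. j < m - 1 \<Longrightarrow> Q j \<noteq> 0"
      using iff nz g by blast+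
    have E': "E j = (if b (Suc j) > r (Suc j) \<and> r (Suc j) > b (Suc (Suc j)) then -1 else 1)" if "j < m" for j
      using n(3)[OF that] unfolding E_def by (rule entry_wt_sign)
    have Q': "Q j = (if r (Suc j) = r (Suc (Suc j)) \<and> r (Suc (Suc j)) = b (Suc (Suc j)) then -1 else 1)"
      if "j < m - 1" for j
      using n(4)[OF that] unfolding Q_def by (rule pair_wt_sign)
    have "(\<Prod>j<m. E j) = (\<Prod>j\<in>{1..m}. if b j > r j \<and> r j > b (j + 1) then -1 else 1)"
      by (rule prod.reindex_bij_witness[of _ "\<lambda>j. j - 1" Suc])
        (auto simp: E')
    also have "\<dots> = (-1) ^ card {j. 1 \<le> j \<and> j \<le> m \<and> b j > r j \<and> r j > b (j + 1)}"
      by (simp add: power_card_eq_prod[symmetric] conj_assoc)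
    finally have E: "(\<Prod>j<m. E j) = \<dots>" .
    have "(\<Prod>j<m - 1. Q j) = (\<Prod>j\<in>{1..m - 1}. if r j = r (j + 1) \<and> r (j + 1) = b (j + 1) then -1 else 1)"
      by (rule prod.reindex_bij_witness[of _ "\<lambda>j. j - 1" Suc])
        (auto simp: Q')
    also have "\<dots> = (-1) ^ card {j \<in> {1..m - 1}. r j = r (j + 1) \<and> r (j + 1) = b (j + 1)}"
      by (simp add: power_card_eq_prod[symmetric])
    also have "{j \<in> {1..m - 1}. r j = r (j + 1) \<and> r (j + 1) = b (j + 1)}
        = {j. 1 \<le> j \<and> j + 1 \<le> m \<and> r j = r (j + 1) \<and> r (j + 1) = b (j + 1)}"
      using m by auto
    finally have Q: "(\<Prod>j<m - 1. Q j) = (-1) ^ card \<dots>" .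
    have "first_wt (b 1) (b 2) (r 1) = 1" "last_wt (b m) (b (Suc m)) (r m) = 1"
      using n(1,2) by (simp_all add: first_wt_def last_wt_def split: if_splits)
    then show ?thesis
      unfolding wt' E Q by (simp add: row_sc_def power_add)
  qed
  with iff show ?thesis by (auto simp: m_def)
qed

section \<open>Polynomials on integer tuples\<close>

text \<open>Induction by the discrete product rule.\<close>

lemma diff_zero_times_arg: "diff_zero d f \<Longrightarrow> diff_zero (Suc d) (\<lambda>x. of_int x * f x)"
proof (induction d arbitrary: f)
  case (Suc d)
  have "diff_zero (Suc d) (\<lambda>x. of_int x * (f (x + 1) - f x) + f (x + 1))"
    using Suc.IH[of "\<lambda>x. f (x + 1) - f x"] Suc.prems by (intro diff_zero_add diff_zero_shift[of _ f]) simp_all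
  moreover have "(\<lambda>x. of_int x * (f (x + 1) - f x) + f (x + 1)) = (\<lambda>x. of_int (x + 1) * f (x + 1) - of_int x * f x)"
    by (simp add: fun_eq_iff algebra_simps)
  ultimately show ?case by simp
qed simp

lemma diff_zero_power: "diff_zero (Suc e) (\<lambda>x. of_int x ^ e)"
  by (induction e) (use diff_zero_times_arg in \<open>auto simp del: diff_zero.simps(2)\<close>)

text \<open>By induction the difference is zero everywhere, so \<open>h\<close> is constant, with
  the value 0 taken above \<open>c\<close>.\<close>

lemma diff_zero_eq_zero:
  assumes "diff_zero d h" and "\<And>x. x > c \<Longrightarrow> h x = 0"
  shows "h x = 0"
  using assms
proof (induction d arbitrary: h x)
  case (Suc d)
  have step: "h (x + 1) - h x = 0" for x
    using Suc.IH[of "\<lambda>x. h (x + 1) - h x"] Suc.prems by simp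
  show ?case
  proof (rule int_fun_eqI[where f = h and g = "\<lambda>x. 0" and a = "c + 1"])
    show "h (c + 1) = 0" by (rule Suc.prems(2)) simp
  qed (use step in simp)
qed simp

lemma diff_zero_poly_eval:
  assumes "length us + Suc (length vs) = n"
  shows "diff_zero n (\<lambda>x. poly_eval n c (us @ x # vs))"
  unfolding poly_eval_def
proof (intro diff_zero_sum diff_zero_cmult)
  fix e assume e: "e \<in> exps n"
  define j where "j = length us"
  have j: "j < n" using assms by (simp add: j_def)
  \<comment> \<open>The entry 0 is a placeholder at position \<open>j\<close>, which the product
    omits.\<close>
  have "(\<Prod>i<n. of_int ((us @ x # vs) ! i) ^ (e ! i)) =
      (\<Prod>i\<in>{..<n} - {j}. of_int ((us @ 0 # vs) ! i) ^ (e ! i)) * (of_int x :: rat) ^ (e ! j)" for x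
  proof -
    have "(\<Prod>i\<in>{..<n} - {j}. of_int ((us @ x # vs) ! i) ^ (e ! i) :: rat) =
        (\<Prod>i\<in>{..<n} - {j}. of_int ((us @ 0 # vs) ! i) ^ (e ! i))"
      by (intro prod.cong refl) (auto simp: nth_append nth_Cons' j_def)
    then show ?thesis
      using j by (subst prod.remove[of _ j]) (simp_all add: mult.commute, simp add: j_def)
  qed
  moreover have "diff_zero n (\<lambda>x. of_int x ^ (e ! j))"
    using e j by (intro diff_zero_mono[OF _ diff_zero_power]) (simp add: exps_def Suc_le_eq)
  ultimately show "diff_zero n (\<lambda>x. \<Prod>i<n. of_int ((us @ x # vs) ! i) ^ (e ! i))"
    by (simp add: diff_zero_cmult)
qed

text \<open>Coordinates are freed from right to left: behind a strictly increasing prefix,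
  \<open>h\<close> vanishes for all large values of the next coordinate, hence for all its
  values.\<close>

lemma zero_on_strictly_incr_imp_zero:
  assumes dz: "\<And>us vs. length us + Suc (length vs) = n \<Longrightarrow> diff_zero d (\<lambda>x. h (us @ x # vs))"
    and zero: "\<And>ks. length ks = n \<Longrightarrow> strictly_incr ks \<Longrightarrow> h ks = 0"
    and "length ks = n"
  shows "h ks = 0"
proof -
  have "strictly_incr us \<Longrightarrow> length us + length vs = n \<Longrightarrow> h (us @ vs) = 0" for us vs
  proof (induction vs arbitrary: us)
    case Nil
    then show ?case using zero by simp
  next
    case (Cons v vs)
    define c where "c = (if us = [] then 0 else last us)"
    have above: "h (us @ x # vs) = 0" if "x > c" for x
    proof -
      have "us ! i < x" if "Suc i = length us" for i
        using that \<open>x > c\<close> by (cases us rule: rev_cases) (auto simp: c_def)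
      then have "strictly_incr (us @ [x])"
        using Cons.prems(1) by (auto simp: strictly_incr_def nth_append less_Suc_eq)
      then show ?thesis using Cons.IH[of "us @ [x]"] Cons.prems(2) by simp
    qed
    have "diff_zero d (\<lambda>x. h (us @ x # vs))"
      using Cons.prems(2) by (intro dz) simp
    from diff_zero_eq_zero[OF this above] show ?case .
  qed
  from this[of "[]" ks] show ?thesis
    using assms(3) by (simp add: strictly_incr_def)
qed

lemma poly_eval_unique:
  assumes "\<And>ks. length ks = n \<Longrightarrow> strictly_incr ks \<Longrightarrow> poly_eval n c ks = poly_eval n c' ks"
    and "length ks = n"
  shows "poly_eval n c ks = poly_eval n c' ks"
proof -
  have "poly_eval n c ks - poly_eval n c' ks = 0"
    by (rule zero_on_strictly_incr_imp_zero[where n = n and d = n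
          and h = "\<lambda>ks. poly_eval n c ks - poly_eval n c' ks"])
      (simp_all add: assms diff_zero_diff diff_zero_poly_eval)
  then show ?thesis by simp
qed

text \<open>Newton's forward difference formula: both sides agree at 0 and, by Pascal's rule, have
  the same differences.\<close>

lemma newton_expansion:
  fixes h :: "int \<Rightarrow> rat"
  assumes "diff_zero d h"
  shows "h x = (\<Sum>i<d. ((\<lambda>h x. h (x + 1) - h x) ^^ i) h 0 * (of_int x gchoose i))"
  using assms
proof (induction d arbitrary: h x)
  case (Suc d)
  define D where "D = (\<lambda>(h :: int \<Rightarrow> rat) x. h (x + 1) - h x)"
  have IH: "D h x = (\<Sum>i<d. (D ^^ i) (D h) 0 * (of_int x gchoose i))" for x
    unfolding D_def by (rule Suc.IH) (use Suc.prems in simp)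
  show ?case
    unfolding D_def[symmetric]
  proof (rule int_fun_eqI[where a = 0 and f = h])
    show "h 0 = (\<Sum>i<Suc d. (D ^^ i) h 0 * (of_int 0 gchoose i))"
      unfolding sum.lessThan_Suc_shift by simp
  next
    fix x
    have "(\<Sum>i<Suc d. (D ^^ i) h 0 * (of_int (x + 1) gchoose i)) - (\<Sum>i<Suc d. (D ^^ i) h 0 * (of_int x gchoose i))
       = (\<Sum>i<d. (D ^^ Suc i) h 0 * (of_int x gchoose i))"
      unfolding sum.lessThan_Suc_shift
      by (simp add: gbinomial_Suc_Suc distrib_left sum.distrib)
    also have "\<dots> = D h x"
      by (simp only: IH[of x] funpow_Suc_right o_apply)
    finally show "h (x + 1) - h x = (\<Sum>i<Suc d. (D ^^ i) h 0 * (of_int (x + 1) gchoose i))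
       - (\<Sum>i<Suc d. (D ^^ i) h 0 * (of_int x gchoose i))"
      by (simp add: D_def)
  qed
qed simp

lemma gbinomial_monomials:
  "\<exists>s. \<forall>x::rat. x gchoose i = (\<Sum>j\<le>i. s j * x ^ j)"
proof (induction i)
  case 0
  show ?case by (rule exI[of _ "\<lambda>_. 1"]) simp
next
  case (Suc i)
  then obtain s where s: "x gchoose i = (\<Sum>j\<le>i. s j * x ^ j)" for x :: rat by blast
  \<comment> \<open>Coefficients of \<open>(x - i) * (x gchoose i)\<close> divided by
    \<open>i + 1\<close>; \<open>s\<close> is controlled only up to index \<open>i\<close>, hence
    the cut-off.\<close>
  define s' where "s' j = ((if j = 0 then 0 else s (j - 1)) - (if j \<le> i then of_nat i * s j else 0)) / of_nat (Suc i)" for j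
  have "x gchoose Suc i = (\<Sum>j\<le>Suc i. s' j * x ^ j)" for x :: rat
  proof -
    have "(x gchoose Suc i) * of_nat (Suc i) = (x - of_nat i) * (x gchoose i)"
      using gbinomial_mult_1[of x i] by (simp add: algebra_simps)
    also have "\<dots> = (\<Sum>j\<le>i. s j * x ^ Suc j) - (\<Sum>j\<le>i. of_nat i * s j * x ^ j)"
      unfolding s left_diff_distrib sum_distrib_left by (simp add: mult_ac sum_subtractf)
    also have "\<dots> = (\<Sum>j\<le>Suc i. (if j = 0 then 0 else s (j - 1)) * x ^ j)
        - (\<Sum>j\<le>Suc i. (if j \<le> i then of_nat i * s j else 0) * x ^ j)"
      by (subst sum.atMost_Suc_shift) simp
    also have "\<dots> = (\<Sum>j\<le>Suc i. s' j * x ^ j) * of_nat (Suc i)"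
    proof -
      have "s' j * x ^ j * of_nat (Suc i) = (s' j * of_nat (Suc i)) * x ^ j" for j
        by (simp only: mult_ac)
      moreover have "s' j * of_nat (Suc i) = (if j = 0 then 0 else s (j - 1)) - (if j \<le> i then of_nat i * s j else 0)" for j
        by (simp add: s'_def del: of_nat_Suc)
      ultimately show ?thesis
        by (simp only: sum_distrib_right sum_subtractf[symmetric] left_diff_distrib)
    qed
    finally show ?thesis by (simp del: of_nat_Suc)
  qed
  then show ?case by blast
qed

text \<open>Newton expansion in the first variable; its coefficients are differences at 0, which
  keep the degree bounds in the other variables, so induction applies to them.\<close>

lemma monomial_expansion:
  assumes "\<And>us vs. length us + Suc (length vs) = m \<Longrightarrow> diff_zero d (\<lambda>x. H (us @ x # vs))"
  shows "\<exists>c. \<forall>ks. length ks = m \<longrightarrow> H ks =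
    (\<Sum>e | set e \<subseteq> {..<d} \<and> length e = m. c e * (\<Prod>i<m. of_int (ks ! i) ^ (e ! i)))"
  using assms
proof (induction m arbitrary: H)
  case 0
  have "{e. set e \<subseteq> {..<d} \<and> length e = 0} = {[]}" by auto
  then show ?case by (intro exI[of _ "\<lambda>e. H []"]) simp
next
  case (Suc m)
  define D where "D = (\<lambda>(h :: int \<Rightarrow> rat) x. h (x + 1) - h x)"
  define N where "N i ks = (D ^^ i) (\<lambda>x. H (x # ks)) 0" for i ks
  have "diff_zero d (\<lambda>y. (D ^^ i) (\<lambda>x. H (x # us @ y # vs)) z)"
    if "length us + Suc (length vs) = m" for us vs i z
  proof (induction i arbitrary: z)
    case 0
    show ?case using Suc.prems[of "z # us" vs] that by simp
  next
    case (Suc i)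
    then show ?case by (simp add: D_def diff_zero_diff)
  qed
  then have N: "diff_zero d (\<lambda>y. N i (us @ y # vs))" if "length us + Suc (length vs) = m" for us vs i
    using that by (simp add: N_def)
  have "\<forall>i. \<exists>s. \<forall>x::rat. x gchoose i = (\<Sum>j\<le>i. s j * x ^ j)"
    using gbinomial_monomials by blast
  from choice[OF this] obtain s where s: "\<And>i (x::rat). x gchoose i = (\<Sum>j\<le>i. s i j * x ^ j)"
    by blast
  \<comment> \<open>\<open>K j\<close> is the coefficient of the \<open>j\<close>-th power of the
    first variable after expanding the binomials.\<close>
  define K where "K j ks = (\<Sum>i<d. (if j \<le> i then s i j else 0) * N i ks)" for j ks
  have "diff_zero d (\<lambda>x. K j (us @ x # vs))" if "length us + Suc (length vs) = m" for j us vs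
    unfolding K_def by (rule diff_zero_sum, rule diff_zero_cmult, rule N[OF that])
  then have "\<exists>c. \<forall>ks. length ks = m \<longrightarrow> K j ks =
      (\<Sum>e | set e \<subseteq> {..<d} \<and> length e = m. c e * (\<Prod>i<m. of_int (ks ! i) ^ (e ! i)))" for j
    by (rule Suc.IH)
  then have "\<forall>j. \<exists>c. \<forall>ks. length ks = m \<longrightarrow> K j ks =
      (\<Sum>e | set e \<subseteq> {..<d} \<and> length e = m. c e * (\<Prod>i<m. of_int (ks ! i) ^ (e ! i)))"
    by (rule allI)
  from choice[OF this] obtain c where c: "\<And>j ks. length ks = m \<Longrightarrow> K j ks =
      (\<Sum>e | set e \<subseteq> {..<d} \<and> length e = m. c j e * (\<Prod>i<m. of_int (ks ! i) ^ (e ! i)))"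
    by blast
  have H: "H (x # ks) = (\<Sum>j<d. K j ks * of_int x ^ j)" if "length ks = m" for x ks
  proof -
    have "diff_zero d (\<lambda>x. H (x # ks))"
      using Suc.prems[of "[]" ks] that by simp
    then have "H (x # ks) = (\<Sum>i<d. N i ks * (of_int x gchoose i))"
      unfolding N_def D_def by (rule newton_expansion)
    also have "\<dots> = (\<Sum>i<d. \<Sum>j<d. (if j \<le> i then s i j else 0) * N i ks * of_int x ^ j)"
    proof (rule sum.cong[OF refl])
      fix i assume "i \<in> {..<d}"
      then have "(\<Sum>j\<le>i. s i j * of_int x ^ j) = (\<Sum>j<d. (if j \<le> i then s i j else 0) * of_int x ^ j)"
        by (intro sum.mono_neutral_cong_left) auto
      then show "N i ks * (of_int x gchoose i) = (\<Sum>j<d. (if j \<le> i then s i j else 0) * N i ks * of_int x ^ j)"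
        by (simp add: s sum_distrib_left mult_ac)
    qed
    also have "\<dots> = (\<Sum>j<d. K j ks * of_int x ^ j)"
      unfolding K_def sum_distrib_right by (rule sum.swap)
    finally show ?thesis .
  qed
  show ?case
  proof (intro exI allI impI)
    fix ks :: "int list" assume "length ks = Suc m"
    then obtain x ks' where ks: "ks = x # ks'" "length ks' = m" by (cases ks) auto
    have "H ks = (\<Sum>j<d. \<Sum>e | set e \<subseteq> {..<d} \<and> length e = m.
        c j e * (\<Prod>i<m. of_int (ks' ! i) ^ (e ! i)) * of_int x ^ j)"
      using H[OF ks(2)] c[OF ks(2)] by (simp add: ks(1) sum_distrib_right)
    also have "\<dots> = (\<Sum>(e, j)\<in>{e. set e \<subseteq> {..<d} \<and> length e = m} \<times> {..<d}.
        c j e * (\<Prod>i<m. of_int (ks' ! i) ^ (e ! i)) * of_int x ^ j)"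
      by (subst sum.swap) (simp add: sum.cartesian_product)
    also have "\<dots> = (\<Sum>e | set e \<subseteq> {..<d} \<and> length e = Suc m.
        c (hd e) (tl e) * (\<Prod>i<Suc m. of_int (ks ! i) ^ (e ! i)))"
      unfolding lists_length_Suc_eq
      by (subst sum.reindex)
        (auto simp: inj_on_def ks(1) prod.lessThan_Suc_shift mult_ac simp del: prod.lessThan_Suc intro!: sum.cong)
    finally show "H ks = \<dots>" .
  qed
qed

lemma poly_eval_exists:
  assumes "\<And>us vs. length us + Suc (length vs) = n \<Longrightarrow> diff_zero n (\<lambda>x. H (us @ x # vs))"
  shows "\<exists>c. \<forall>ks. length ks = n \<longrightarrow> poly_eval n c ks = H ks"
proof -
  have exps: "exps n = {e. set e \<subseteq> {..<n} \<and> length e = n}"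
    by (auto simp: exps_def subset_eq all_set_conv_all_nth)
  from monomial_expansion[of n n H, OF assms] obtain c where
    "\<And>ks. length ks = n \<Longrightarrow> H ks =
      (\<Sum>e | set e \<subseteq> {..<n} \<and> length e = n. c e * (\<Prod>i<n. of_int (ks ! i) ^ (e ! i)))"
    by blast
  then have "\<forall>ks. length ks = n \<longrightarrow> poly_eval n c ks = H ks"
    by (simp add: poly_eval_def exps)
  then show ?thesis by blast
qed

section \<open>The signed count\<close>

text \<open>The value 0 on lists of other lengths frees the recursion and the antisymmetry from
  length conditions.\<close>

definition gmt_sum :: "nat \<Rightarrow> int list \<Rightarrow> rat" where
  "gmt_sum n ks = (if length ks = n then \<Sum>A\<in>GMT_set n ks. (-1) ^ sc n A else 0)"

section \<open>Adding and removing the bottom row\<close>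

definition add_row :: "nat \<Rightarrow> int list \<Rightarrow> (nat \<Rightarrow> nat \<Rightarrow> int) \<Rightarrow> nat \<Rightarrow> nat \<Rightarrow> int" where
  "add_row m ks B = B(Suc m := \<lambda>j. if 1 \<le> j \<and> j \<le> Suc m then ks ! (j - 1) else 0)"

lemma add_row_GMT:
  assumes B: "B \<in> GMT_set m ls" and len: "length ls = m" "length ks = Suc m"
  shows "add_row m ks B \<in> GMT_set (Suc m) ks \<longleftrightarrow> row_wt None ks ls \<noteq> 0"
    and "row_wt None ks ls \<noteq> 0 \<Longrightarrow>
      (-1) ^ sc (Suc m) (add_row m ks B) = row_wt None ks ls * (-1) ^ sc m B"
proof -
  define b where "b = add_row m ks B (Suc m)"
  from B have tri: "tri_ext m B" and rows: "\<forall>i<m. gmt_row i (B (i + 1)) (B i)" and bot: "bottom_row m ls B"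
    by (auto simp: GMT_set_def GMT_iff_gmt_row)
  have wt: "row_wt None ks ls = (if gmt_row m b (B m) then (-1) ^ row_sc m b (B m) else 0)"
    using row_wt_None_eq[of ks ls b "B m"] bot len by (simp add: b_def add_row_def bottom_row_def)
  have [simp]: "add_row m ks B i = B i" if "i \<le> m" for i
    using that by (simp add: add_row_def)
  have "tri_ext (Suc m) (add_row m ks B)" "bottom_row (Suc m) ks (add_row m ks B)"
    using tri by (auto simp: tri_ext_def bottom_row_def add_row_def)
  then show "add_row m ks B \<in> GMT_set (Suc m) ks \<longleftrightarrow> row_wt None ks ls \<noteq> 0"
    using rows by (auto simp: GMT_set_def GMT_iff_gmt_row wt b_def less_Suc_eq)
  have "sc (Suc m) (add_row m ks B) = sc m B + row_sc m b (B m)"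
    by (simp add: sc_eq_sum_row_sc b_def)
  then show "(-1) ^ sc (Suc m) (add_row m ks B) = row_wt None ks ls * (-1) ^ sc m B"
    if "row_wt None ks ls \<noteq> 0"
    using that by (simp add: wt power_add split: if_splits)
qed

lemma GMT_set_SucE:
  assumes "A \<in> GMT_set (Suc m) ks" and "length ks = Suc m"
  defines "B \<equiv> A(Suc m := \<lambda>j. 0)" and "ls \<equiv> map (\<lambda>j. A m (Suc j)) [0..<m]"
  shows "B \<in> GMT_set m ls" and "A = add_row m ks B" and "row_wt None ks ls \<noteq> 0"
proof -
  from assms have tri: "tri_ext (Suc m) A" and rows: "\<forall>i<Suc m. gmt_row i (A (i + 1)) (A i)"
    and bot: "bottom_row (Suc m) ks A"
    by (auto simp: GMT_set_def GMT_iff_gmt_row)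
  have "tri_ext m B"
    using tri unfolding tri_ext_def B_def by (metis fun_upd_apply le_SucE)
  moreover have "bottom_row m ls B"
    by (auto simp: bottom_row_def B_def ls_def)
  ultimately show B: "B \<in> GMT_set m ls"
    using rows by (auto simp: GMT_set_def GMT_iff_gmt_row B_def)
  show A: "A = add_row m ks B"
  proof (intro ext)
    fix i j show "A i j = add_row m ks B i j"
      using tri bot by (auto simp: add_row_def B_def bottom_row_def tri_ext_def)
  qed
  show "row_wt None ks ls \<noteq> 0"
    using add_row_GMT(1)[OF B _ assms(2)] assms(1) A[symmetric] by (simp add: ls_def)
qed

lemma GMT_set_0: "GMT_set 0 [] = {\<lambda>i j. 0}"
  by (auto simp: GMT_set_def GMT_iff_gmt_row tri_ext_def bottom_row_def fun_eq_iff)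

lemma length_rows: "ls \<in> rows ks \<Longrightarrow> length ls = length ks - 1"
  by (induction ks arbitrary: ls rule: rows.induct) auto

lemma finite_GMT_set: "length ks = n \<Longrightarrow> finite (GMT_set n ks)"
proof (induction n arbitrary: ks)
  case 0
  then show ?case by (simp add: GMT_set_0)
next
  case (Suc m)
  have "GMT_set (Suc m) ks \<subseteq> add_row m ks ` (\<Union>ls\<in>rows ks. GMT_set m ls)"
  proof
    fix A assume "A \<in> GMT_set (Suc m) ks"
    note A = GMT_set_SucE[OF this Suc.prems]
    show "A \<in> add_row m ks ` (\<Union>ls\<in>rows ks. GMT_set m ls)"
      by (rule image_eqI, rule A(2), rule UN_I, rule row_wt_rows[OF A(3)], rule A(1))
  qed
  moreover have "finite (\<Union>ls\<in>rows ks. GMT_set m ls)"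
    using Suc length_rows by (intro finite_UN_I) auto
  ultimately show ?case using finite_surj by blast
qed

lemma gmt_sum_0: "gmt_sum 0 = (\<lambda>ks. if ks = [] then 1 else 0)"
  by (auto simp: gmt_sum_def GMT_set_0 sc_eq_sum_row_sc)

text \<open>A triangle corresponds to its penultimate row together with the triangle ending there;
  the signs multiply by \<open>add_row_GMT\<close>.\<close>

lemma gmt_sum_Suc_weighted:
  assumes len: "length ks = Suc m"
  shows "gmt_sum (Suc m) ks = weighted_sum None (gmt_sum m) ks"
proof -
  \<comment> \<open>Rows of weight zero extend no triangle; they are left out for the bijection and
    restored at the end.\<close>
  define R where "R = {ls \<in> rows ks. row_wt None ks ls \<noteq> 0}"
  have R: "length ls = m" if "ls \<in> R" for ls
    using that length_rows[of ls ks] len by (simp add: R_def)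
  have row: "map (\<lambda>j. add_row m ks B m (Suc j)) [0..<m] = ls" if "B \<in> GMT_set m ls" "length ls = m" for B ls
    using that by (intro nth_equalityI) (simp_all add: add_row_def GMT_set_def bottom_row_def)
  have restr: "(add_row m ks B)(Suc m := \<lambda>j. 0) = B" if "B \<in> GMT_set m ls" for B ls
    using that by (auto simp: add_row_def GMT_set_def GMT_iff_gmt_row tri_ext_def fun_eq_iff)
  have "gmt_sum (Suc m) ks = (\<Sum>(ls, B)\<in>Sigma R (GMT_set m). row_wt None ks ls * (-1) ^ sc m B)"
    unfolding gmt_sum_def if_P[OF len]
  proof (rule sum.reindex_bij_witness[of _ "\<lambda>(ls, B). add_row m ks B"
        "\<lambda>A. (map (\<lambda>j. A m (Suc j)) [0..<m], A(Suc m := \<lambda>j. 0))"], goal_cases)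
    case (1 A)
    then show ?case using GMT_set_SucE(2)[OF 1 len] by simp
  next
    case (2 A)
    then show ?case using GMT_set_SucE[OF 2 len] row_wt_rows by (auto simp: R_def)
  next
    case (3 x)
    then show ?case using row restr R by auto
  next
    case (4 x)
    then show ?case using add_row_GMT(1)[OF _ _ len] R by (auto simp: R_def)
  next
    case (5 A)
    note A = GMT_set_SucE[OF 5 len]
    from add_row_GMT(2)[OF A(1) _ len A(3)] A(2) show ?case by simp
  qed
  also have "\<dots> = (\<Sum>ls\<in>R. \<Sum>B\<in>GMT_set m ls. row_wt None ks ls * (-1) ^ sc m B)"
    using R by (subst sum.Sigma) (auto simp: R_def intro: finite_GMT_set)
  also have "\<dots> = (\<Sum>ls\<in>R. row_wt None ks ls * gmt_sum m ls)"
    using R by (intro sum.cong) (simp_all add: gmt_sum_def sum_distrib_left)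
  also have "\<dots> = weighted_sum None (gmt_sum m) ks"
    unfolding weighted_sum_def by (intro sum.mono_neutral_left) (auto simp: R_def)
  finally show ?thesis .
qed

text \<open>Above three equal neighbours (1) forces two equal entries, which (2) forbids.\<close>

lemma gmt_sum_triple: "gmt_sum n (us @ x # x # x # vs) = 0"
proof -
  have False if A: "A \<in> GMT_set n ks" and len: "length ks = n" and ks: "ks = us @ x # x # x # vs" for A ks
  proof -
    define j where "j = Suc (length us)"
    obtain m where m: "n = Suc m" "j + 1 \<le> m" using len ks by (auto simp: j_def)
    from A have g: "gmt_row m (A n) (A m)" and b: "bottom_row n ks A"
      by (auto simp: GMT_set_def GMT_iff_gmt_row m)
    from b m have [simp]: "A n j = x" "A n (Suc j) = x" "A n (Suc (Suc j)) = x"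
      by (auto simp: bottom_row_def j_def ks nth_append)
    note g = g[unfolded gmt_row_def]
    have "1 \<le> j" by (simp add: j_def)
    then have "A m j = x" "A m (Suc j) = x"
      using g[THEN conjunct1, rule_format, of j] g[THEN conjunct1, rule_format, of "Suc j"] m(2)
      by simp_all
    with g[THEN conjunct2, THEN conjunct1, rule_format, of j] m(2) \<open>1 \<le> j\<close> show False by simp
  qed
  then have "GMT_set n (us @ x # x # x # vs) = {}" if "length (us @ x # x # x # vs) = n"
    using that by blast
  then show ?thesis by (auto simp: gmt_sum_def)
qed

lemma gmt_sum_Suc: "gmt_sum (Suc m) ks = row_sum (gmt_sum m) ks"
proof (cases ks)
  case Nil
  then show ?thesis by (simp add: gmt_sum_def)
next
  case (Cons k ks')
  have "gmt_sum (Suc m) ks = weighted_sum None (gmt_sum m) ks"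
  proof (cases "length ks = Suc m")
    \<comment> \<open>As \<open>ks\<close> is nonempty, its rows then have a length other than
      \<open>m\<close>, and both sides are zero.\<close>
    case False
    then show ?thesis
      using length_rows[of _ ks] Cons by (auto simp: weighted_sum_def gmt_sum_def)
  qed (rule gmt_sum_Suc_weighted)
  also have "\<dots> = row_sum (gmt_sum m) ks"
    unfolding Cons by (rule weighted_sum_eq_row_sum(1)) (simp_all add: gmt_sum_triple)
  finally show ?thesis .
qed

lemma shift_antisym_gmt_sum: "shift_antisym (\<lambda>x y. gmt_sum n (us @ x # y # vs))"
proof (induction n arbitrary: us vs)
  case (Suc n)
  then show ?case unfolding gmt_sum_Suc by (rule shift_antisym_row_sum_entries)
qed (simp add: gmt_sum_0)

text \<open>Each new row raises the degree by one only; \<open>gmt_sum 0\<close> vanishes on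
  nonempty lists, which starts the induction.\<close>

lemma diff_zero_gmt_sum: "diff_zero n (\<lambda>x. gmt_sum n (us @ x # vs))"
proof (induction n arbitrary: us vs)
  case (Suc n)
  show ?case unfolding gmt_sum_Suc
    by (rule diff_zero_row_sum_entry) (rule shift_antisym_gmt_sum, rule Suc)
qed (simp add: gmt_sum_0)

text \<open>All rows are strictly increasing, so (3) is vacuous, (1) becomes interlacing, and
  neither newcomers nor sign-changing pairs occur.\<close>

lemma MT_set_eq_GMT_set:
  assumes len: "length ks = n" and "strictly_incr ks"
  shows "MT_set n ks = GMT_set n ks"
    and "A \<in> GMT_set n ks \<Longrightarrow> sc n A = 0"
proof -
  \<comment> \<open>Strict increase passes by (2) from each row to the one above, starting at the
    bottom row \<open>n\<close>.\<close>
  have incr: "A i j < A i (j + 1)"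
    if A: "A \<in> GMT_set n ks" and "i \<le> n" "1 \<le> j" "j + 1 \<le> i" for A i j
    using \<open>i \<le> n\<close> that(3,4)
  proof (induction i arbitrary: j rule: inc_induct)
    case base
    then obtain i where "j = Suc i" by (cases j) auto
    with base A assms show ?case
      by (simp add: GMT_set_def bottom_row_def strictly_incr_def)
  next
    case (step i)
    from A have "gmt_row i (A (i + 1)) (A i)"
      using step.hyps by (simp add: GMT_set_def GMT_iff_gmt_row)
    moreover have "A (i + 1) j \<le> A (i + 1) (j + 1)" "A (i + 1) (j + 1) \<le> A (i + 1) (j + 2)"
      using step.IH[of j] step.IH[of "j + 1"] step.prems by simp_all
    ultimately show ?case
      using step.prems unfolding gmt_row_def by blast
  qed
  have "monotone_triangle n A" if A: "A \<in> GMT_set n ks" for A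
    unfolding monotone_triangle_def
  proof (intro conjI allI impI; (elim conjE)?)
    show "tri_ext n A" using A by (simp add: GMT_set_def GMT_def)
    show "A i j < A i (j + 1)" if "1 \<le> j" "j + 1 \<le> i" "i \<le> n" for i j
      using incr[OF A] that by blast
    fix i j assume ij: "1 \<le> j" "j \<le> i" "i < n"
    with A have "min (A (i + 1) j) (A (i + 1) (j + 1)) \<le> A i j \<and> A i j \<le> max (A (i + 1) j) (A (i + 1) (j + 1))"
      by (simp add: GMT_set_def GMT_def)
    moreover have "A (i + 1) j < A (i + 1) (j + 1)"
      using incr[OF A, of "i + 1" j] ij by simp
    ultimately show "A (i + 1) j \<le> A i j" "A i j \<le> A (i + 1) (j + 1)" by simp_all
  qed
  moreover have "GMT n A" if "monotone_triangle n A" for A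
  proof -
    from that have tri: "tri_ext n A" and inc: "\<And>i j. \<lbrakk>1 \<le> j; j + 1 \<le> i; i \<le> n\<rbrakk> \<Longrightarrow> A i j < A i (j + 1)"
      and le: "\<And>i j. \<lbrakk>1 \<le> j; j \<le> i; i < n\<rbrakk> \<Longrightarrow> A (i + 1) j \<le> A i j \<and> A i j \<le> A (i + 1) (j + 1)"
      by (auto simp: monotone_triangle_def)
    have "gmt_row i (A (i + 1)) (A i)" if "i < n" for i
      unfolding gmt_row_def
    proof (intro conjI allI impI; elim conjE)
      fix j assume j: "1 \<le> j" "j \<le> i"
      then show "min (A (i + 1) j) (A (i + 1) (j + 1)) \<le> A i j" "A i j \<le> max (A (i + 1) j) (A (i + 1) (j + 1))"
        using le[of j i] that by simp_all
      have asc: "A (i + 1) j < A (i + 1) (j + 1)"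
        using inc[of j "i + 1"] j that by simp
      show "2 \<le> j" "A i (j - 1) = A i j" if "A (i + 1) (j + 1) < A (i + 1) j"
        using asc that by simp_all
      show "j + 1 \<le> i" "A i (j + 1) = A i j" if "A (i + 1) (j + 1) < A (i + 1) j"
        using asc that by simp_all
    next
      fix j assume "1 \<le> j" "j + 1 \<le> i"
      then show "A i j < A i (j + 1)"
        using inc[of j i] that by simp
    qed
    with tri show ?thesis by (simp add: GMT_iff_gmt_row)
  qed
  ultimately show "MT_set n ks = GMT_set n ks"
    by (auto simp: MT_set_def GMT_set_def)
  show "sc n A = 0" if A: "A \<in> GMT_set n ks"
  proof -
    have "\<not> (1 \<le> j \<and> j \<le> i \<and> i < n \<and> A (i + 1) j > A i j \<and> A i j > A (i + 1) (j + 1))" for i j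
      using incr[OF A, of "i + 1" j] by linarith
    then have "newcomers n A = {}"
      by (simp add: newcomers_def)
    moreover have "\<not> (1 \<le> j \<and> j + 1 \<le> i \<and> i < n \<and> A i j = A i (j + 1) \<and> A i (j + 1) = A (i + 1) (j + 1))" for i j
      using incr[OF A, of i j] by linarith
    then have "sign_changing n A = {}"
      by (simp add: sign_changing_def)
    ultimately show ?thesis by (simp add: sc_def)
  qed
qed

lemma gmt_sum_strictly_incr:
  assumes "length ks = n" "strictly_incr ks"
  shows "gmt_sum n ks = of_nat (card (MT_set n ks))"
  using MT_set_eq_GMT_set[OF assms] assms(1) by (simp add: gmt_sum_def)

theorem theorem1:
  fixes n :: nat and ks :: "int list"
  assumes "n \<ge> 1" and "length ks = n"
  shows "alpha n ks = (\<Sum>A\<in>GMT_set n ks. (-1::rat) ^ sc n A)"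
proof -
  obtain c where c: "\<And>ks. length ks = n \<Longrightarrow> poly_eval n c ks = gmt_sum n ks"
    using poly_eval_exists[of n "gmt_sum n"] diff_zero_gmt_sum by blast
  have count: "poly_eval n c ks' = of_nat (card (MT_set n ks'))"
    if "length ks' = n" "strictly_incr ks'" for ks'
    using that by (simp add: c gmt_sum_strictly_incr)
  have "alpha n ks = poly_eval n c ks"
    unfolding alpha_def
  proof (rule the_equality)
    show "\<exists>c'. (\<forall>ks'. length ks' = n \<and> strictly_incr ks' \<longrightarrow>
        poly_eval n c' ks' = of_nat (card (MT_set n ks'))) \<and> poly_eval n c ks = poly_eval n c' ks"
      using count by blast
    \<comment> \<open>Any coefficient function with the right counts agrees with \<open>c\<close> on
      strictly increasing rows, hence also at \<open>ks\<close>.\<close>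
    fix v
    assume "\<exists>c'. (\<forall>ks'. length ks' = n \<and> strictly_incr ks' \<longrightarrow>
        poly_eval n c' ks' = of_nat (card (MT_set n ks'))) \<and> v = poly_eval n c' ks"
    then obtain c' where c': "\<And>ks'. length ks' = n \<Longrightarrow> strictly_incr ks' \<Longrightarrow>
        poly_eval n c' ks' = of_nat (card (MT_set n ks'))" and v: "v = poly_eval n c' ks"
      by blast
    show "v = poly_eval n c ks"
      unfolding v by (rule poly_eval_unique) (simp_all add: c' count assms(2))
  qed
  with c[OF assms(2)] assms(2) show ?thesis
    by (simp add: gmt_sum_def)
qed

end
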